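(* There is a constant $C>0$, depending only on $p$, $d$ and $\Omega$, such that for every $\varepsilon=[\varepsilon_-,\varepsilon_+]$ with $0<\varepsilon_-\le\varepsilon_+<\infty$ and every $0<\lambda\le\varepsilon_+/c_1$, $$\mathcal J_\varepsilon(u_\varepsilon)-\mathcal J(u)\le C\Big(\varepsilon_-^p+\int_{\mathcal O_\lambda(u)}|\nabla u|^p\,dx\Big).$$
   Context: Standing setting: $\Omega\subset\mathbb R^d$ is open and bounded, $1<p<2$, $f\in (W_0^{1,p}(\Omega))^*$. The energy is $\mathcal J(v):=\frac1p\int_\Omega|\nabla v|^p\,dx-\langle f,v\rangle$ on $W_0^{1,p}(\Omega)$ and $u$ is its unique minimizer. For $\varepsilon=[\varepsilon_-,\varepsilon_+]$ with $0<\varepsilon_-\le\varepsilon_+<\infty$ define $$\kappa_\varepsilon(t):=\begin{cases}\frac12\varepsilon_-^{p-2}t^2+(\frac1p-\frac12)\varepsilon_-^p & t\le\varepsilon_-,\\ \frac1p t^p & \varepsilon_-\le t\le\varepsilon_+,\\ \frac12\varepsilon_+^{p-2}t^2+(\frac1p-\frac12)\varepsilon_+^p & t\ge\varepsilon_+,\end{cases}$$ and $\mathcal J_\varepsilon(v):=\int_\Omega\kappa_\varepsilon(|\nabla v|)\,dx-\langle f,v\rangle$, as a functional $W_0^{1,p}(\Omega)\to\mathbb R\cup\{\infty\}$ (finite exactly on $W_0^{1,2}(\Omega)$); $u_\varepsilon$ is its unique minimizer. For $v\in W_0^{1,p}(\Omega)$ and $\lambda>0$ let $\mathcal O_\lambda(v):=\{x\in\Omega: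 M(\nabla v)(x)>\lambda\}$, where $(Mg)(x):=\sup_{r>0}\frac1{|B_r(x)|}\int_{B_r(x)}|g|\,dy$ and $\nabla v$ is extended by zero outside $\Omega$. Lipschitz truncation (a result from earlier literature which the paper takes as available on $\Omega$, and which fixes $c_1$): for every $v\in W_0^{1,p}(\Omega)$ and $\lambda>0$ there is $T_\lambda v\in W_0^{1,\infty}(\Omega)$ such that, with constants depending only on $p,d,\Omega$: $\{v\ne T_\lambda v\}\subset\mathcal O_\lambda(v)$; $\|T_\lambda v\|_{L^p}\lesssim\|v\|_{L^p}$; $\|\nabla T_\lambda v\|_{L^p}\lesssim\|\nabla v\|_{L^p}$; $|\nabla T_\lambda v|\lesssim\lambda\chi_{\mathcal O_\lambda(v)}+|\nabla v|\chi_{\Omega\setminus\mathcal O_\lambda(v)}$, so that $|\nabla T_\lambda v|\le c_1\lambda$ a.e.; $\|\nabla(v-T_\lambda v)\|_{L^p(\Omega)}\lesssim\|\nabla v\|_{L^p(\mathcal O_\lambda(v))}$; $T_\lambda v\to v$ in $W_0^{1,p}(\Omega)$ as $\lambda\to\infty$. The constant $c_1$ in the claim is the constant in $|\nabla T_\lambda v|\le c_1\lambda$. *)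

theory Defs
  imports "HOL-Analysis.Analysis"
begin

section \<open>Test functions\<close>

primrec C_k :: "nat \<Rightarrow> ('a::euclidean_space \<Rightarrow> real) \<Rightarrow> bool" where
  "C_k 0 f \<longleftrightarrow> continuous_on UNIV f"
| "C_k (Suc k) f \<longleftrightarrow> (\<forall>x. f differentiable (at x)) \<and>
     (\<forall>b\<in>Basis. C_k k (\<lambda>x. frechet_derivative f (at x) b))"

definition grad :: "('a::euclidean_space \<Rightarrow> real) \<Rightarrow> 'a \<Rightarrow> 'a" where
  "grad f x = (\<Sum>b\<in>Basis. frechet_derivative f (at x) b *\<^sub>R b)"

definition test_functions :: "'a::euclidean_space set \<Rightarrow> ('a \<Rightarrow> real) set" where
  "test_functions \<Omega> = {\<phi>. (\<forall>k. C_k k \<phi>) \<and> compact (closure {x. \<phi> x \<noteq> 0}) \<and>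
     closure {x. \<phi> x \<noteq> 0} \<subseteq> \<Omega>}"


section \<open>Lebesgue and Sobolev spaces\<close>

text \<open>Elements of these spaces are functions, not classes modulo null sets; only their
  values on \<open>\<Omega>\<close> matter, and these only up to null sets.\<close>

definition Lp :: "'a::euclidean_space set \<Rightarrow> real \<Rightarrow> ('a \<Rightarrow> 'b::euclidean_space) set" where
  "Lp \<Omega> p = {g \<in> borel_measurable (lebesgue_on \<Omega>).
     integrable (lebesgue_on \<Omega>) (\<lambda>x. norm (g x) powr p)}"

definition Lp_norm :: "'a::euclidean_space set \<Rightarrow> real \<Rightarrow> ('a \<Rightarrow> 'b::euclidean_space) \<Rightarrow> real" where
  "Lp_norm \<Omega> p g = (\<integral>x. norm (g x) powr p \<partial>lebesgue_on \<Omega>) powr (1 / p)"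

definition Linf :: "'a::euclidean_space set \<Rightarrow> ('a \<Rightarrow> 'b::euclidean_space) set" where
  "Linf \<Omega> = {g \<in> borel_measurable (lebesgue_on \<Omega>). \<exists>B. AE x in lebesgue_on \<Omega>. norm (g x) \<le> B}"

definition locally_integrable :: "'a::euclidean_space set \<Rightarrow> ('a \<Rightarrow> 'b::euclidean_space) \<Rightarrow> bool" where
  "locally_integrable \<Omega> g \<longleftrightarrow> (\<forall>K. compact K \<and> K \<subseteq> \<Omega> \<longrightarrow> set_integrable lebesgue K g)"

definition is_weak_gradient :: "'a::euclidean_space set \<Rightarrow> ('a \<Rightarrow> real) \<Rightarrow> ('a \<Rightarrow> 'a) \<Rightarrow> bool" where
  "is_weak_gradient \<Omega> v g \<longleftrightarrow> locally_integrable \<Omega> v \<and> locally_integrable \<Omega> g \<and>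
     (\<forall>\<phi>\<in>test_functions \<Omega>.
        (\<integral>x. v x *\<^sub>R grad \<phi> x \<partial>lebesgue_on \<Omega>) = - (\<integral>x. \<phi> x *\<^sub>R g x \<partial>lebesgue_on \<Omega>))"

text \<open>On an open set the weak gradient is unique up to null sets, so for weakly
  differentiable \<open>v\<close> the choice below only picks a representative. For other \<open>v\<close> the
  value is meaningless.\<close>

definition wgrad :: "'a::euclidean_space set \<Rightarrow> ('a \<Rightarrow> real) \<Rightarrow> 'a \<Rightarrow> 'a" where
  "wgrad \<Omega> v = (SOME g. is_weak_gradient \<Omega> v g)"

definition W1 :: "'a::euclidean_space set \<Rightarrow> real \<Rightarrow> ('a \<Rightarrow> real) set" where
  "W1 \<Omega> p = {v \<in> Lp \<Omega> p. \<exists>g\<in>Lp \<Omega> p. is_weak_gradient \<Omega> v g}"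

definition W1_norm :: "'a::euclidean_space set \<Rightarrow> real \<Rightarrow> ('a \<Rightarrow> real) \<Rightarrow> real" where
  "W1_norm \<Omega> p v = Lp_norm \<Omega> p v + Lp_norm \<Omega> p (wgrad \<Omega> v)"

definition W1_0 :: "'a::euclidean_space set \<Rightarrow> real \<Rightarrow> ('a \<Rightarrow> real) set" where
  "W1_0 \<Omega> p = {v \<in> W1 \<Omega> p. \<exists>\<phi>. (\<forall>n::nat. \<phi> n \<in> test_functions \<Omega>) \<and>
     (\<lambda>n. W1_norm \<Omega> p (\<lambda>x. v x - \<phi> n x)) \<longlonglongrightarrow> 0}"

definition W1_inf :: "'a::euclidean_space set \<Rightarrow> ('a \<Rightarrow> real) set" where
  "W1_inf \<Omega> = {v \<in> Linf \<Omega>. \<exists>g\<in>Linf \<Omega>. is_weak_gradient \<Omega> v g}"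

text \<open>The norm closure of the test functions would be too small here (it contains only
  \<open>C\<^sup>1\<close> functions); the usual convention is the intersection with \<open>W\<^sub>0\<^sup>1\<^sup>,\<^sup>1\<close>.\<close>

definition W1_inf_0 :: "'a::euclidean_space set \<Rightarrow> ('a \<Rightarrow> real) set" where
  "W1_inf_0 \<Omega> = W1_inf \<Omega> \<inter> W1_0 \<Omega> 1"

text \<open>Boundedness makes such a functional insensitive to changes of \<open>v\<close> on null sets.\<close>

definition W1_0_dual :: "'a::euclidean_space set \<Rightarrow> real \<Rightarrow> (('a \<Rightarrow> real) \<Rightarrow> real) set" where
  "W1_0_dual \<Omega> p = {f.
     (\<forall>v\<in>W1_0 \<Omega> p. \<forall>w\<in>W1_0 \<Omega> p. f (\<lambda>x. v x + w x) = f v + f w) \<and>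
     (\<forall>c. \<forall>v\<in>W1_0 \<Omega> p. f (\<lambda>x. c * v x) = c * f v) \<and>
     (\<exists>K. \<forall>v\<in>W1_0 \<Omega> p. \<bar>f v\<bar> \<le> K * W1_norm \<Omega> p v)}"


section \<open>Energies\<close>

definition energy :: "'a::euclidean_space set \<Rightarrow> real \<Rightarrow> (('a \<Rightarrow> real) \<Rightarrow> real) \<Rightarrow> ('a \<Rightarrow> real) \<Rightarrow> real" where
  "energy \<Omega> p f v = 1 / p * (\<integral>x. norm (wgrad \<Omega> v x) powr p \<partial>lebesgue_on \<Omega>) - f v"

definition kappa :: "real \<Rightarrow> real \<Rightarrow> real \<Rightarrow> real \<Rightarrow> real" where
  "kappa p em ep t =
     (if t \<le> em then 1 / 2 * em powr (p - 2) * t\<^sup>2 + (1 / p - 1 / 2) * em powr p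
      else if t \<le> ep then 1 / p * t powr p
      else 1 / 2 * ep powr (p - 2) * t\<^sup>2 + (1 / p - 1 / 2) * ep powr p)"

text \<open>The integrand is nonnegative for \<open>0 < p \<le> 2\<close>, so the nonnegative integral is the
  integral of \<open>kappa\<close>, with value \<open>\<infinity>\<close> where it diverges.\<close>

definition relaxed_energy ::
  "'a::euclidean_space set \<Rightarrow> real \<Rightarrow> (('a \<Rightarrow> real) \<Rightarrow> real) \<Rightarrow> real \<Rightarrow> real \<Rightarrow> ('a \<Rightarrow> real) \<Rightarrow> ereal" where
  "relaxed_energy \<Omega> p f em ep v =
     enn2ereal (\<integral>\<^sup>+x. ennreal (kappa p em ep (norm (wgrad \<Omega> v x))) \<partial>lebesgue_on \<Omega>) - ereal (f v)"


section \<open>Maximal function and Lipschitz truncation\<close>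

definition maximal_function :: "('a::euclidean_space \<Rightarrow> 'b::euclidean_space) \<Rightarrow> 'a \<Rightarrow> ennreal" where
  "maximal_function g x =
     (SUP r\<in>{0<..}. (\<integral>\<^sup>+y\<in>ball x r. ennreal (norm (g y)) \<partial>lebesgue) / emeasure lebesgue (ball x r))"

definition bad_set :: "'a::euclidean_space set \<Rightarrow> ('a \<Rightarrow> real) \<Rightarrow> real \<Rightarrow> 'a set" where
  "bad_set \<Omega> v l =
     {x \<in> \<Omega>. maximal_function (\<lambda>y. if y \<in> \<Omega> then wgrad \<Omega> v y else 0) x > ennreal l}"

text \<open>The constant \<open>c\<close> serves all estimates whose constant is not named; it does not depend on
  \<open>v\<close> and \<open>l\<close>. Membership of \<open>T l v\<close> in \<open>W1_0 \<Omega> p\<close> belongs to the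
  convergence \<open>T l v \<longlongrightarrow> v\<close> in that space.\<close>

definition lipschitz_truncation ::
  "'a::euclidean_space set \<Rightarrow> real \<Rightarrow> real \<Rightarrow> real \<Rightarrow> (real \<Rightarrow> ('a \<Rightarrow> real) \<Rightarrow> 'a \<Rightarrow> real) \<Rightarrow> bool" where
  "lipschitz_truncation \<Omega> p c1 c T \<longleftrightarrow>
     (\<forall>v\<in>W1_0 \<Omega> p. \<forall>l>0.
        T l v \<in> W1_inf_0 \<Omega> \<and>
        (AE x in lebesgue_on \<Omega>. v x \<noteq> T l v x \<longrightarrow> x \<in> bad_set \<Omega> v l) \<and>
        Lp_norm \<Omega> p (T l v) \<le> c * Lp_norm \<Omega> p v \<and>
        Lp_norm \<Omega> p (wgrad \<Omega> (T l v)) \<le> c * Lp_norm \<Omega> p (wgrad \<Omega> v) \<and>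
        (AE x in lebesgue_on \<Omega>. norm (wgrad \<Omega> (T l v) x)
           \<le> c * (l * indicator (bad_set \<Omega> v l) x
                  + norm (wgrad \<Omega> v x) * indicator (\<Omega> - bad_set \<Omega> v l) x)) \<and>
        (AE x in lebesgue_on \<Omega>. norm (wgrad \<Omega> (T l v) x) \<le> c1 * l) \<and>
        Lp_norm \<Omega> p (wgrad \<Omega> (\<lambda>x. v x - T l v x))
          \<le> c * Lp_norm (bad_set \<Omega> v l) p (wgrad \<Omega> v)) \<and>
     (\<forall>v\<in>W1_0 \<Omega> p. (\<forall>l>0. T l v \<in> W1_0 \<Omega> p) \<and>
        ((\<lambda>l. W1_norm \<Omega> p (\<lambda>x. T l v x - v x)) \<longlongrightarrow> 0) at_top)"

end

theory Submission
  imports Defs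
begin

text \<open>Put \<open>w = T l u\<close> and \<open>k = u - w\<close>. Since \<open>norm (wgrad \<Omega> w)\<close> is at most \<open>ep\<close>, the
  relaxed energy of \<open>w\<close> exceeds its energy by at most a multiple of \<open>em powr p\<close>. For
  \<open>p \<le> 2\<close> one has \<open>norm (a + h) powr p + norm (a - h) powr p \<le> 2 * norm a powr p + 2 * norm h powr p\<close>;
  with \<open>a = wgrad \<Omega> u\<close> and \<open>h = wgrad \<Omega> k\<close> this bounds the sum of the energies of \<open>u + k\<close> and
  \<open>u - k = w\<close>. The energy of \<open>u + k\<close> is at least that of \<open>u\<close>, so no Euler--Lagrange
  equation is needed, and the energy of \<open>w\<close> exceeds that of \<open>u\<close> by at most a multiple of the
  integral of \<open>norm (wgrad \<Omega> k) powr p\<close>, which the truncation estimate controls by the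
  integral over the bad set. Linearity of \<open>wgrad\<close> up to null sets rests on the uniqueness of
  weak gradients: the smooth functions \<open>box_bump a b n\<close> tend to the indicator of a box, and a locally
  integrable function whose integrals over all boxes vanish is zero almost everywhere.\<close>

section \<open>Smooth functions\<close>

lemma C_k_SucD:
  assumes "C_k (Suc k) f"
  shows "f differentiable (at x)" "b \<in> Basis \<Longrightarrow> C_k k (\<lambda>x. frechet_derivative f (at x) b)"
  using assms by simp_all

lemma C_k_SucI:
  assumes "\<And>x. f differentiable (at x)"
    and "\<And>b. b \<in> Basis \<Longrightarrow> C_k k (\<lambda>x. frechet_derivative f (at x) b)"
  shows "C_k (Suc k) f"
  using assms by simp

text \<open>This serves the product rule, where one factor stays undifferentiated and must be
  regular of the lower order.\<close>

lemma C_k_lower: "C_k (Suc k) f \<Longrightarrow> C_k k f"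
proof (induction k arbitrary: f)
  case 0
  then have "f differentiable_on UNIV"
    by (simp add: differentiable_on_def)
  then show ?case
    by (simp add: differentiable_imp_continuous_on)
next
  case (Suc k)
  note d = C_k_SucD[OF Suc.prems]
  show ?case
    by (rule C_k_SucI[OF d(1) Suc.IH[OF d(2)]])
qed

lemma frechet_derivative_add:
  fixes f g :: "'a::euclidean_space \<Rightarrow> real"
  assumes "f differentiable (at x)" "g differentiable (at x)"
  shows "frechet_derivative (\<lambda>x. f x + g x) (at x) b
    = frechet_derivative f (at x) b + frechet_derivative g (at x) b"
proof -
  have "((\<lambda>x. f x + g x) has_derivative
      (\<lambda>h. frechet_derivative f (at x) h + frechet_derivative g (at x) h)) (at x)"
    by (intro has_derivative_add assms[unfolded frechet_derivative_works])
  from fun_cong[OF frechet_derivative_at[OF this], of b] show ?thesis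
    by (rule sym)
qed

lemma frechet_derivative_mult:
  fixes f g :: "'a::euclidean_space \<Rightarrow> real"
  assumes "f differentiable (at x)" "g differentiable (at x)"
  shows "frechet_derivative (\<lambda>x. f x * g x) (at x) b
    = f x * frechet_derivative g (at x) b + frechet_derivative f (at x) b * g x"
proof -
  have "((\<lambda>x. f x * g x) has_derivative
      (\<lambda>h. f x * frechet_derivative g (at x) h + frechet_derivative f (at x) h * g x)) (at x)"
    by (intro has_derivative_mult assms[unfolded frechet_derivative_works])
  from fun_cong[OF frechet_derivative_at[OF this], of b] show ?thesis
    by (rule sym)
qed

lemma C_k_const: "C_k k (\<lambda>x. c)"
  by (induction k arbitrary: c) (auto simp: frechet_derivative_const)

lemma C_k_add: "C_k k f \<Longrightarrow> C_k k g \<Longrightarrow> C_k k (\<lambda>x. f x + g x)"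
proof (induction k arbitrary: f g)
  case 0
  then show ?case by (simp add: continuous_on_add)
next
  case (Suc k)
  note d = C_k_SucD(1)[OF Suc.prems(1)] C_k_SucD(1)[OF Suc.prems(2)]
  show ?case
  proof (rule C_k_SucI)
    fix b :: 'a assume b: "b \<in> Basis"
    show "C_k k (\<lambda>x. frechet_derivative (\<lambda>x. f x + g x) (at x) b)"
      unfolding frechet_derivative_add[OF d]
      by (rule Suc.IH[OF C_k_SucD(2)[OF Suc.prems(1) b] C_k_SucD(2)[OF Suc.prems(2) b]])
  qed (intro differentiable_add d)
qed

lemma C_k_mult: "C_k k f \<Longrightarrow> C_k k g \<Longrightarrow> C_k k (\<lambda>x. f x * g x)"
proof (induction k arbitrary: f g)
  case 0
  then show ?case by (simp add: continuous_on_mult)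
next
  case (Suc k)
  note d = C_k_SucD(1)[OF Suc.prems(1)] C_k_SucD(1)[OF Suc.prems(2)]
  note l = C_k_lower[OF Suc.prems(1)] C_k_lower[OF Suc.prems(2)]
  show ?case
  proof (rule C_k_SucI)
    fix b :: 'a assume b: "b \<in> Basis"
    show "C_k k (\<lambda>x. frechet_derivative (\<lambda>x. f x * g x) (at x) b)"
      unfolding frechet_derivative_mult[OF d]
      by (rule C_k_add[OF Suc.IH[OF l(1) C_k_SucD(2)[OF Suc.prems(2) b]]
            Suc.IH[OF C_k_SucD(2)[OF Suc.prems(1) b] l(2)]])
  qed (intro differentiable_mult d)
qed

lemma C_k_prod:
  assumes "\<And>i. i \<in> I \<Longrightarrow> C_k k (f i)"
  shows "C_k k (\<lambda>x. \<Prod>i\<in>I. f i x)"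
  using assms by (induction I rule: infinite_finite_induct) (auto intro: C_k_const C_k_mult)

section \<open>A flat exponential on the line and smooth bumps on boxes\<close>

text \<open>The case \<open>m = 0\<close> is the classical smooth function that is flat at 0. The
  parameter \<open>m\<close> is there because derivatives of members of the family are linear
  combinations of members.\<close>

definition flat_exp :: "nat \<Rightarrow> real \<Rightarrow> real" where
  "flat_exp m t = (if t > 0 then exp (- 1 / t) / t ^ m else 0)"

lemma flat_exp_has_real_derivative:
  "(flat_exp m has_real_derivative flat_exp (m + 2) t - m * flat_exp (m + 1) t) (at t)"
proof (rule linorder_cases[of t 0])
  assume t: "t < 0"
  have "(flat_exp m has_real_derivative 0) (at t)"
    by (rule has_field_derivative_transform_within_open[of "\<lambda>_. 0" _ _ "{..<0}"])
      (use t in \<open>auto simp: flat_exp_def\<close>)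
  with t show ?thesis by (simp add: flat_exp_def)
next
  assume t: "t > 0"
  have "((\<lambda>t. exp (- 1 / t)) has_real_derivative exp (- 1 / t) / t ^ 2) (at t)"
    using t by (auto intro!: derivative_eq_intros simp: power2_eq_square)
  from DERIV_divide[OF this DERIV_pow[of m]]
  have "((\<lambda>t. exp (- 1 / t) / t ^ m) has_real_derivative
      (exp (- 1 / t) / t ^ 2 * t ^ m - exp (- 1 / t) * (real m * t ^ (m - Suc 0)))
        / (t ^ m * t ^ m)) (at t)"
    using t by simp
  \<comment> \<open>For \<open>m = 0\<close> the truncated exponent \<open>m - Suc 0\<close> is 0
    and not -1, but its factor \<open>real m\<close> vanishes; hence the case split on
    \<open>m\<close>.\<close>
  also have "(exp (- 1 / t) / t ^ 2 * t ^ m - exp (- 1 / t) * (real m * t ^ (m - Suc 0)))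
      / (t ^ m * t ^ m) = flat_exp (m + 2) t - m * flat_exp (m + 1) t"
    using t by (cases m) (auto simp: flat_exp_def field_simps power2_eq_square)
  finally have "((\<lambda>t. exp (- 1 / t) / t ^ m) has_real_derivative
      flat_exp (m + 2) t - m * flat_exp (m + 1) t) (at t)" .
  then show ?thesis
    by (rule has_field_derivative_transform_within_open[of _ _ _ "{0<..}"])
      (use t in \<open>auto simp: flat_exp_def\<close>)
next
  assume t: "t = 0"
  \<comment> \<open>With \<open>y = inverse h\<close> the quotient is
    \<open>y ^ (m + 1) / exp y\<close>, and the exponential dominates every power as
    \<open>y\<close> grows.\<close>
  have "((\<lambda>h. exp (- 1 / h) / h ^ m / h) \<longlongrightarrow> 0) (at_right (0::real))"
  proof -
    have "((\<lambda>y. y ^ (m + 1) / exp y) \<longlongrightarrow> (0::real)) at_top"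
      by (rule tendsto_power_div_exp_0)
    then have "((\<lambda>h. inverse h ^ (m + 1) / exp (inverse h)) \<longlongrightarrow> (0::real)) (at_right 0)"
      by (rule filterlim_compose[OF _ filterlim_inverse_at_top_right])
    then show ?thesis
      by (simp add: exp_minus field_simps)
  qed
  then have r: "((\<lambda>h. flat_exp m h / h) \<longlongrightarrow> 0) (at_right 0)"
    by (rule tendsto_cong[THEN iffD1, rotated])
      (auto simp: eventually_at_filter flat_exp_def)
  have l: "((\<lambda>h. flat_exp m h / h) \<longlongrightarrow> 0) (at_left 0)"
    by (rule tendsto_cong[THEN iffD1, rotated, of "\<lambda>_. 0"])
      (auto simp: eventually_at_filter flat_exp_def)
  have "((\<lambda>h. flat_exp m h / h) \<longlongrightarrow> 0) (at 0)"
    using l r by (simp add: filterlim_split_at)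
  with t show ?thesis
    by (simp add: DERIV_def flat_exp_def)
qed

text \<open>The derivative is arranged as a sum with constant factors, so that
  \<open>C_k_add\<close>, \<open>C_k_mult\<close> and \<open>C_k_const\<close> fit it
  literally.\<close>

lemma flat_exp_inner_has_derivative:
  "((\<lambda>x::'a::euclidean_space. flat_exp m (s * (x \<bullet> e) + c)) has_derivative
    (\<lambda>h. (s * (h \<bullet> e)) * (flat_exp (m + 2) (s * (x \<bullet> e) + c)
      + (- real m) * flat_exp (m + 1) (s * (x \<bullet> e) + c)))) (at x)"
proof -
  have "((\<lambda>x::'a. s * (x \<bullet> e) + c) has_derivative (\<lambda>h. s * (h \<bullet> e))) (at x)"
    by (auto intro!: derivative_eq_intros)
  from DERIV_compose_FDERIV[OF flat_exp_has_real_derivative this]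
  show ?thesis by (simp add: algebra_simps)
qed

text \<open>The induction keeps \<open>m\<close> arbitrary, since each differentiation leads to
  \<open>m + 1\<close> and \<open>m + 2\<close>.\<close>

lemma C_k_flat_exp: "C_k k (\<lambda>x::'a::euclidean_space. flat_exp m (s * (x \<bullet> e) + c))"
proof (induction k arbitrary: m)
  case 0
  show ?case
    unfolding C_k.simps
    by (rule has_derivative_continuous_on)
      (rule has_derivative_at_withinI[OF flat_exp_inner_has_derivative])
next
  case (Suc k)
  note D = flat_exp_inner_has_derivative[of m s e c]
  have fd: "frechet_derivative (\<lambda>x::'a. flat_exp m (s * (x \<bullet> e) + c)) (at x) b
      = (s * (b \<bullet> e)) * (flat_exp (m + 2) (s * (x \<bullet> e) + c)
        + (- real m) * flat_exp (m + 1) (s * (x \<bullet> e) + c))" for x b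
    using fun_cong[OF frechet_derivative_at[OF D], of b] by (rule sym)
  show ?case
  proof (rule C_k_SucI)
    show "(\<lambda>x::'a. flat_exp m (s * (x \<bullet> e) + c)) differentiable at x" for x
      using D unfolding differentiable_def by blast
    show "C_k k (\<lambda>x. frechet_derivative (\<lambda>x::'a. flat_exp m (s * (x \<bullet> e) + c)) (at x) b)" for b
      unfolding fd
      by (rule C_k_mult[OF C_k_const C_k_add[OF Suc.IH C_k_mult[OF C_k_const Suc.IH]]])
  qed
qed

text \<open>For \<open>x\<close> inside the box each factor is \<open>exp (- 1 / (s * d))\<close>
  with \<open>d > 0\<close> the distance to a face. It tends to 1 as \<open>s\<close> grows, so the
  bumps approach the indicator of the open box.\<close>

definition box_bump :: "'a::euclidean_space \<Rightarrow> 'a \<Rightarrow> real \<Rightarrow> 'a \<Rightarrow> real" where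
  "box_bump a b s x = (\<Prod>e\<in>Basis. flat_exp 0 (s * (x \<bullet> e - a \<bullet> e)) * flat_exp 0 (s * (b \<bullet> e - x \<bullet> e)))"

lemma C_k_box_bump: "C_k k (box_bump a b s)"
proof -
  have "C_k k (\<lambda>x. \<Prod>e\<in>Basis. flat_exp 0 (s * (x \<bullet> e) + (- s * (a \<bullet> e)))
      * flat_exp 0 ((- s) * (x \<bullet> e) + s * (b \<bullet> e)))"
    by (intro C_k_prod C_k_mult C_k_flat_exp)
  moreover have "box_bump a b s = (\<lambda>x. \<Prod>e\<in>Basis. flat_exp 0 (s * (x \<bullet> e) + (- s * (a \<bullet> e)))
      * flat_exp 0 ((- s) * (x \<bullet> e) + s * (b \<bullet> e)))"
    by (auto simp: box_bump_def fun_eq_iff algebra_simps)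
  ultimately show ?thesis by simp
qed

lemma flat_exp_0_bounds: "0 \<le> flat_exp 0 t" "flat_exp 0 t \<le> 1"
  by (auto simp: flat_exp_def)

lemma box_bump_bounds: "0 \<le> box_bump a b s x" "box_bump a b s x \<le> 1"
  by (auto simp: box_bump_def flat_exp_0_bounds intro!: prod_nonneg prod_le_1 mult_le_one)

lemma box_bump_outside:
  assumes "s > 0" "x \<notin> box a b"
  shows "box_bump a b s x = 0"
  using assms by (auto simp: box_bump_def mem_box flat_exp_def zero_less_mult_iff)

lemma box_bump_tendsto_indicator:
  "(\<lambda>n. box_bump a b (real (Suc n)) x) \<longlonglongrightarrow> indicator (box a b) x"
proof (cases "x \<in> box a b")
  case True
  have lim: "(\<lambda>n. flat_exp 0 (real (Suc n) * d)) \<longlonglongrightarrow> 1" if "d > 0" for d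
  proof -
    have "(\<lambda>n. exp (- (inverse (real (Suc n)) / d))) \<longlonglongrightarrow> exp (- (0 / d))"
      using that by (intro tendsto_intros LIMSEQ_inverse_real_of_nat) auto
    moreover have "flat_exp 0 (real (Suc n) * d) = exp (- (inverse (real (Suc n)) / d))" for n
      using that by (simp add: flat_exp_def field_simps del: of_nat_Suc)
    ultimately show ?thesis by simp
  qed
  have "(\<lambda>n. box_bump a b (real (Suc n)) x) \<longlonglongrightarrow> (\<Prod>e\<in>(Basis::'a set). 1 * 1)"
    unfolding box_bump_def using True
    by (intro tendsto_prod tendsto_mult lim) (auto simp: mem_box)
  with True show ?thesis by simp
next
  case False
  then show ?thesis by (simp add: box_bump_outside)
qed

text \<open>The bump is nonzero only in the open box, so the closure of that set stays in the closed
  box, which has to lie in \<open>\<Omega>\<close>.\<close>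

lemma box_bump_test_function:
  assumes "s > 0" "cbox a b \<subseteq> \<Omega>"
  shows "box_bump a b s \<in> test_functions \<Omega>"
proof -
  have sub: "{x. box_bump a b s x \<noteq> 0} \<subseteq> cbox a b"
    using box_bump_outside[OF assms(1)] box_subset_cbox by blast
  then have "closure {x. box_bump a b s x \<noteq> 0} \<subseteq> cbox a b"
    by (simp add: closure_minimal closed_cbox)
  moreover have "compact (closure {x. box_bump a b s x \<noteq> 0})"
    using sub bounded_cbox bounded_subset compact_closure by metis
  ultimately show ?thesis
    using assms C_k_box_bump by (auto simp: test_functions_def)
qed


section \<open>Test functions and weak gradients\<close>

lemma grad_has_derivative:
  assumes "\<phi> differentiable (at x)"
  shows "(\<phi> has_derivative (\<lambda>h. grad \<phi> x \<bullet> h)) (at x)"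
proof -
  have D: "(\<phi> has_derivative frechet_derivative \<phi> (at x)) (at x)"
    using assms by (simp add: frechet_derivative_works)
  then interpret linear "frechet_derivative \<phi> (at x)"
    by (rule has_derivative_linear)
  have "frechet_derivative \<phi> (at x) h = grad \<phi> x \<bullet> h" for h
  proof -
    have "frechet_derivative \<phi> (at x) h = frechet_derivative \<phi> (at x) (\<Sum>b\<in>Basis. (h \<bullet> b) *\<^sub>R b)"
      by (simp add: euclidean_representation)
    also have "\<dots> = (\<Sum>b\<in>Basis. (h \<bullet> b) * frechet_derivative \<phi> (at x) b)"
      by (simp add: sum scaleR)
    also have "\<dots> = grad \<phi> x \<bullet> h"
      unfolding grad_def inner_sum_left inner_scaleR_left
      by (intro sum.cong refl) (simp add: inner_commute mult.commute)
    finally show ?thesis .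
  qed
  then have "frechet_derivative \<phi> (at x) = (\<lambda>h. grad \<phi> x \<bullet> h)"
    by (rule ext)
  with D show ?thesis by (simp only:)
qed

lemma grad_eqI:
  assumes "(\<phi> has_derivative (\<lambda>h. g \<bullet> h)) (at x)"
  shows "grad \<phi> x = g"
proof -
  have "frechet_derivative \<phi> (at x) = (\<lambda>h. g \<bullet> h)"
    using frechet_derivative_at[OF assms] by simp
  then show ?thesis
    by (simp add: grad_def euclidean_representation)
qed

lemma test_functionsE:
  assumes "\<phi> \<in> test_functions \<Omega>"
  obtains K where "compact K" "K \<subseteq> \<Omega>" "\<And>x. x \<notin> K \<Longrightarrow> \<phi> x = 0" "\<And>x. x \<notin> K \<Longrightarrow> grad \<phi> x = 0"
    "continuous_on UNIV \<phi>" "continuous_on UNIV (grad \<phi>)" "\<And>x. \<phi> differentiable (at x)"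
proof
  define K where "K = closure {x. \<phi> x \<noteq> 0}"
  have A: "(\<forall>k. C_k k \<phi>) \<and> compact (closure {x. \<phi> x \<noteq> 0}) \<and>
      closure {x. \<phi> x \<noteq> 0} \<subseteq> \<Omega>"
    using assms unfolding test_functions_def by (rule CollectD)
  then have C: "C_k k \<phi>" for k
    by (rule allE[OF conjunct1])
  show K: "compact K" and "K \<subseteq> \<Omega>"
    using A by (simp_all only: K_def)
  show zero: "\<phi> x = 0" if "x \<notin> K" for x
    using that subsetD[OF closure_subset, of x "{x. \<phi> x \<noteq> 0}"] unfolding K_def mem_Collect_eq
    by (rule contrapos_np)
  \<comment> \<open>The complement of the closed set \<open>K\<close> is open, so
    \<open>\<phi>\<close> agrees with the zero function near \<open>x\<close>.\<close>
  show "grad \<phi> x = 0" if "x \<notin> K" for x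
  proof (rule grad_eqI)
    have "((\<lambda>_. 0) has_derivative (\<lambda>h. 0)) (at x)"
      by simp
    then show "(\<phi> has_derivative (\<lambda>h. 0 \<bullet> h)) (at x)"
      unfolding inner_zero_left
      by (rule has_derivative_transform_within_open[of _ _ _ _ "- K"])
        (use that zero K in \<open>simp_all add: compact_imp_closed open_Compl\<close>)
  qed
  show "\<phi> differentiable (at x)" for x
    using C[of "Suc 0"] by (rule C_k_SucD)
  show "continuous_on UNIV \<phi>"
    using C[of 0] by simp
  have "continuous_on UNIV (\<lambda>x. frechet_derivative \<phi> (at x) b)" if "b \<in> Basis" for b
    using C_k_SucD(2)[OF C[of "Suc 0"] that] by simp
  then show "continuous_on UNIV (grad \<phi>)"
    unfolding grad_def by (intro continuous_intros)
qed

section \<open>Integrability against continuous functions of compact support\<close>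

lemma integrable_lebesgue_on_zero_outside:
  fixes F :: "'a::euclidean_space \<Rightarrow> 'b::euclidean_space"
  assumes "open \<Omega>" "\<And>x. x \<notin> \<Omega> \<Longrightarrow> F x = 0"
  shows "integrable (lebesgue_on \<Omega>) F \<longleftrightarrow> integrable lebesgue F"
    and "integral\<^sup>L (lebesgue_on \<Omega>) F = integral\<^sup>L lebesgue F"
proof -
  have "(\<lambda>x. indicator \<Omega> x *\<^sub>R F x) = F"
    using assms(2) by (auto simp: fun_eq_iff indicator_def)
  then show "integrable (lebesgue_on \<Omega>) F \<longleftrightarrow> integrable lebesgue F"
    and "integral\<^sup>L (lebesgue_on \<Omega>) F = integral\<^sup>L lebesgue F"
    using assms(1) by (simp_all add: integrable_restrict_space integral_restrict_space)
qed

lemma continuous_on_borel_measurable_lebesgue: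
  fixes \<psi> :: "'a::euclidean_space \<Rightarrow> 'b::euclidean_space"
  shows "continuous_on UNIV \<psi> \<Longrightarrow> \<psi> \<in> borel_measurable lebesgue"
  by (simp add: borel_measurable_continuous_onI measurable_completion)

lemma continuous_compact_support_bounded:
  fixes \<psi> :: "'a::euclidean_space \<Rightarrow> 'b::euclidean_space"
  assumes "compact K" "continuous_on UNIV \<psi>" "\<And>x. x \<notin> K \<Longrightarrow> \<psi> x = 0"
  obtains B where "B \<ge> 0" "\<And>x. norm (\<psi> x) \<le> B"
proof -
  have "bounded (\<psi> ` K)"
    using assms by (meson compact_continuous_image compact_imp_bounded continuous_on_subset subset_UNIV)
  then obtain B where "\<And>x. x \<in> K \<Longrightarrow> norm (\<psi> x) \<le> B"
    by (auto simp: bounded_iff)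
  then have "norm (\<psi> x) \<le> max B 0" for x
    using assms(3)[of x] by (cases "x \<in> K") (auto simp: le_max_iff_disj)
  then show ?thesis using that[of "max B 0"] by auto
qed

lemma continuous_compact_support_integrable:
  fixes \<psi> :: "'a::euclidean_space \<Rightarrow> 'b::euclidean_space"
  assumes "compact K" "continuous_on UNIV \<psi>" "\<And>x. x \<notin> K \<Longrightarrow> \<psi> x = 0"
  shows "integrable lebesgue \<psi>"
proof -
  have "integrable lborel (\<lambda>x. indicator K x *\<^sub>R \<psi> x)"
    using assms by (intro borel_integrable_compact) (auto intro: continuous_on_subset)
  moreover have "(\<lambda>x. indicator K x *\<^sub>R \<psi> x) = \<psi>"
    using assms(3) by (auto simp: fun_eq_iff indicator_def)
  ultimately show ?thesis
    using assms(2) by (simp add: integrable_completion borel_measurable_continuous_onI)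
qed

lemma continuous_integrable_on_compact:
  fixes \<psi> :: "'a::euclidean_space \<Rightarrow> 'b::euclidean_space"
  assumes "compact K" "continuous_on UNIV \<psi>"
  shows "set_integrable lebesgue K \<psi>"
proof -
  have "integrable lborel (\<lambda>x. indicator K x *\<^sub>R \<psi> x)"
    using assms by (intro borel_integrable_compact) (auto intro: continuous_on_subset)
  then show ?thesis
    unfolding set_integrable_def
    by (subst integrable_completion) (auto dest: borel_measurable_integrable)
qed

lemma locally_integrable_scaleR:
  fixes \<psi> :: "'a::euclidean_space \<Rightarrow> 'b::euclidean_space"
  assumes "locally_integrable \<Omega> v" "compact K" "K \<subseteq> \<Omega>"
    and "continuous_on UNIV \<psi>" "\<And>x. x \<notin> K \<Longrightarrow> \<psi> x = 0"
  shows "integrable lebesgue (\<lambda>x. v x *\<^sub>R \<psi> x)"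
proof -
  obtain B where B: "B \<ge> 0" "\<And>x. norm (\<psi> x) \<le> B"
    using continuous_compact_support_bounded assms by metis
  have i: "integrable lebesgue (\<lambda>x. indicator K x *\<^sub>R v x)"
    using assms by (auto simp: locally_integrable_def set_integrable_def)
  \<comment> \<open>Only the restriction of \<open>v\<close> to \<open>K\<close> is known to be
    integrable. Inserting the indicator changes nothing, as \<open>\<psi>\<close> vanishes off
    \<open>K\<close>.\<close>
  have eq: "v x *\<^sub>R \<psi> x = (indicator K x *\<^sub>R v x) *\<^sub>R \<psi> x" for x
    using assms(5)[of x] by (auto simp: indicator_def)
  show ?thesis
    unfolding eq
  proof (rule Bochner_Integration.integrable_bound)
    show "integrable lebesgue (\<lambda>x. B * norm (indicator K x *\<^sub>R v x))"
      using i by (intro integrable_mult_right integrable_norm)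
    show "(\<lambda>x. (indicator K x *\<^sub>R v x) *\<^sub>R \<psi> x) \<in> borel_measurable lebesgue"
      by (intro borel_measurable_scaleR borel_measurable_integrable[OF i]
          continuous_on_borel_measurable_lebesgue assms)
    show "AE x in lebesgue. norm ((indicator K x *\<^sub>R v x) *\<^sub>R \<psi> x) \<le> norm (B * norm (indicator K x *\<^sub>R v x))"
      using B by (auto simp: abs_mult mult.commute intro!: mult_right_mono)
  qed
qed

lemma locally_integrable_scaleR':
  fixes g :: "'a::euclidean_space \<Rightarrow> 'b::euclidean_space"
  assumes "locally_integrable \<Omega> g" "compact K" "K \<subseteq> \<Omega>"
    and "continuous_on UNIV \<psi>" "\<And>x. x \<notin> K \<Longrightarrow> \<psi> x = 0"
  shows "integrable lebesgue (\<lambda>x. \<psi> x *\<^sub>R g x)"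
proof -
  obtain B where B: "B \<ge> 0" "\<And>x. norm (\<psi> x) \<le> B"
    using continuous_compact_support_bounded assms by metis
  have i: "integrable lebesgue (\<lambda>x. indicator K x *\<^sub>R g x)"
    using assms by (auto simp: locally_integrable_def set_integrable_def)
  have eq: "\<psi> x *\<^sub>R g x = \<psi> x *\<^sub>R indicator K x *\<^sub>R g x" for x
    using assms(5)[of x] by (auto simp: indicator_def)
  show ?thesis
    unfolding eq
  proof (rule Bochner_Integration.integrable_bound)
    show "integrable lebesgue (\<lambda>x. B * norm (indicator K x *\<^sub>R g x))"
      using i by (intro integrable_mult_right integrable_norm)
    show "(\<lambda>x. \<psi> x *\<^sub>R indicator K x *\<^sub>R g x) \<in> borel_measurable lebesgue"
      by (intro borel_measurable_scaleR[OF _ borel_measurable_integrable[OF i]]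
          continuous_on_borel_measurable_lebesgue assms)
    show "AE x in lebesgue. norm (\<psi> x *\<^sub>R indicator K x *\<^sub>R g x) \<le> norm (B * norm (indicator K x *\<^sub>R g x))"
      using B by (intro AE_I2) (auto simp: abs_mult mult.assoc intro!: mult_right_mono)
  qed
qed

lemma locally_integrable_lincomb:
  fixes v w :: "'a::euclidean_space \<Rightarrow> 'b::euclidean_space"
  assumes "locally_integrable \<Omega> v" "locally_integrable \<Omega> w"
  shows "locally_integrable \<Omega> (\<lambda>x. s *\<^sub>R v x + t *\<^sub>R w x)"
  unfolding locally_integrable_def
proof (intro allI impI)
  fix K assume "compact K \<and> K \<subseteq> \<Omega>"
  then have "set_integrable lebesgue K v" "set_integrable lebesgue K w"
    using assms by (auto simp: locally_integrable_def)
  then show "set_integrable lebesgue K (\<lambda>x. s *\<^sub>R v x + t *\<^sub>R w x)"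
    by (intro set_integral_add set_integrable_scaleR_right)
qed

text \<open>Additivity of the Bochner integral needs integrable summands. The compact support of the
  test function supplies this from local integrability.\<close>

lemma is_weak_gradient_integrable:
  fixes \<Omega> :: "'a::euclidean_space set"
  assumes "open \<Omega>" "is_weak_gradient \<Omega> v g" "\<phi> \<in> test_functions \<Omega>"
  shows "integrable (lebesgue_on \<Omega>) (\<lambda>x. v x *\<^sub>R grad \<phi> x)"
    and "integrable (lebesgue_on \<Omega>) (\<lambda>x. \<phi> x *\<^sub>R g x)"
proof -
  obtain K where K: "compact K" "K \<subseteq> \<Omega>" "\<And>x. x \<notin> K \<Longrightarrow> \<phi> x = 0" "\<And>x. x \<notin> K \<Longrightarrow> grad \<phi> x = 0"
    "continuous_on UNIV \<phi>" "continuous_on UNIV (grad \<phi>)" "\<And>x. \<phi> differentiable (at x)"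
    using assms(3) by (rule test_functionsE) blast
  have l: "locally_integrable \<Omega> v" "locally_integrable \<Omega> g"
    using assms by (auto simp: is_weak_gradient_def)
  have z: "v x *\<^sub>R grad \<phi> x = 0" "\<phi> x *\<^sub>R g x = 0" if "x \<notin> \<Omega>" for x
    using K(2-4) that by auto
  show "integrable (lebesgue_on \<Omega>) (\<lambda>x. v x *\<^sub>R grad \<phi> x)"
    by (rule iffD2[OF integrable_lebesgue_on_zero_outside(1)[OF assms(1)]
          locally_integrable_scaleR[OF l(1) K(1,2,6,4)]]) (rule z(1))
  show "integrable (lebesgue_on \<Omega>) (\<lambda>x. \<phi> x *\<^sub>R g x)"
    by (rule iffD2[OF integrable_lebesgue_on_zero_outside(1)[OF assms(1)]
          locally_integrable_scaleR'[OF l(2) K(1,2,5,3)]]) (rule z(2))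
qed

lemma is_weak_gradient_lincomb:
  fixes \<Omega> :: "'a::euclidean_space set"
  assumes "open \<Omega>" "is_weak_gradient \<Omega> v g" "is_weak_gradient \<Omega> w h"
  shows "is_weak_gradient \<Omega> (\<lambda>x. s * v x + t * w x) (\<lambda>x. s *\<^sub>R g x + t *\<^sub>R h x)"
proof -
  have "(\<integral>x. (s * v x + t * w x) *\<^sub>R grad \<phi> x \<partial>lebesgue_on \<Omega>)
      = - (\<integral>x. \<phi> x *\<^sub>R (s *\<^sub>R g x + t *\<^sub>R h x) \<partial>lebesgue_on \<Omega>)"
    if \<phi>: "\<phi> \<in> test_functions \<Omega>" for \<phi>
  proof -
    note I = is_weak_gradient_integrable[OF assms(1) assms(2) \<phi>]
      is_weak_gradient_integrable[OF assms(1) assms(3) \<phi>]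
    have "(\<integral>x. (s * v x + t * w x) *\<^sub>R grad \<phi> x \<partial>lebesgue_on \<Omega>)
      = (\<integral>x. s *\<^sub>R (v x *\<^sub>R grad \<phi> x) + t *\<^sub>R (w x *\<^sub>R grad \<phi> x) \<partial>lebesgue_on \<Omega>)"
      by (simp add: scaleR_add_left)
    also have "\<dots> = s *\<^sub>R (\<integral>x. v x *\<^sub>R grad \<phi> x \<partial>lebesgue_on \<Omega>)
        + t *\<^sub>R (\<integral>x. w x *\<^sub>R grad \<phi> x \<partial>lebesgue_on \<Omega>)"
      by (simp only: Bochner_Integration.integral_add integral_scaleR_right integrable_scaleR_right I simp_thms)
    also have "\<dots> = - (s *\<^sub>R (\<integral>x. \<phi> x *\<^sub>R g x \<partial>lebesgue_on \<Omega>)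
        + t *\<^sub>R (\<integral>x. \<phi> x *\<^sub>R h x \<partial>lebesgue_on \<Omega>))"
      using assms(2,3) \<phi> by (simp add: is_weak_gradient_def)
    also have "\<dots> = - (\<integral>x. s *\<^sub>R (\<phi> x *\<^sub>R g x) + t *\<^sub>R (\<phi> x *\<^sub>R h x) \<partial>lebesgue_on \<Omega>)"
      by (simp only: Bochner_Integration.integral_add integral_scaleR_right integrable_scaleR_right I simp_thms)
    also have "\<dots> = - (\<integral>x. \<phi> x *\<^sub>R (s *\<^sub>R g x + t *\<^sub>R h x) \<partial>lebesgue_on \<Omega>)"
      by (simp add: algebra_simps)
    finally show ?thesis .
  qed
  then show ?thesis
    using assms locally_integrable_lincomb[of \<Omega> v w s t] locally_integrable_lincomb[of \<Omega> g h s t]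
    by (auto simp: is_weak_gradient_def)
qed

section \<open>Uniqueness of weak gradients\<close>

text \<open>The bumps \<open>box_bump a b (real (Suc n))\<close> are test functions converging to
  the indicator of the open box, and their products with \<open>g\<close> are dominated by
  \<open>g\<close> on the closed box.\<close>

lemma integral_box_eq_0:
  fixes g :: "'a::euclidean_space \<Rightarrow> 'b::euclidean_space"
  assumes "open \<Omega>" "locally_integrable \<Omega> g"
    and test: "\<And>\<phi>. \<phi> \<in> test_functions \<Omega> \<Longrightarrow> (\<integral>x. \<phi> x *\<^sub>R g x \<partial>lebesgue_on \<Omega>) = 0"
    and "cbox a b \<subseteq> \<Omega>"
  shows "(\<integral>x. indicator (box a b) x *\<^sub>R g x \<partial>lebesgue) = 0"
proof -
  let ?s = "\<lambda>n x. box_bump a b (real (Suc n)) x *\<^sub>R g x"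
  have T: "box_bump a b (real (Suc n)) \<in> test_functions \<Omega>" for n
    using assms(4) by (intro box_bump_test_function) auto
  have zero: "box_bump a b (real (Suc n)) x = 0" if "x \<notin> cbox a b" for n x
    using that box_subset_cbox by (intro box_bump_outside) auto
  have i: "integrable lebesgue (\<lambda>x. indicator (cbox a b) x *\<^sub>R g x)"
    using assms by (auto simp: locally_integrable_def set_integrable_def)
  have int: "integrable lebesgue (?s n)" for n
    by (rule locally_integrable_scaleR'[OF assms(2) compact_cbox assms(4)])
      (use zero C_k_box_bump[of 0] in auto)
  have z: "integral\<^sup>L lebesgue (?s n) = 0" for n
    using test[OF T] zero assms(4)
    by (subst integrable_lebesgue_on_zero_outside(2)[OF assms(1), symmetric]) auto
  have "(\<lambda>n. integral\<^sup>L lebesgue (?s n)) \<longlonglongrightarrow> (\<integral>x. indicator (box a b) x *\<^sub>R g x \<partial>lebesgue)"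
  proof (rule integral_dominated_convergence)
    \<comment> \<open>Measurability of \<open>g\<close> is available only on compact subsets of
      \<open>\<Omega>\<close>, so it is drawn from the integrable cutoff to the closed box.\<close>
    have "(\<lambda>x. indicator (box a b) x *\<^sub>R (indicator (cbox a b) x *\<^sub>R g x)) \<in> borel_measurable lebesgue"
      by (rule borel_measurable_scaleR[OF borel_measurable_indicator borel_measurable_integrable[OF i]]) simp
    moreover have "(\<lambda>x. indicator (box a b) x *\<^sub>R (indicator (cbox a b) x *\<^sub>R g x))
        = (\<lambda>x. indicator (box a b) x *\<^sub>R g x)"
      using box_subset_cbox[of a b] by (auto simp: indicator_def fun_eq_iff)
    ultimately show "(\<lambda>x. indicator (box a b) x *\<^sub>R g x) \<in> borel_measurable lebesgue"
      by simp
    show "?s n \<in> borel_measurable lebesgue" for n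
      using int by (rule borel_measurable_integrable)
    show "integrable lebesgue (\<lambda>x. norm (indicator (cbox a b) x *\<^sub>R g x))"
      using i by (rule integrable_norm)
    show "AE x in lebesgue. (\<lambda>n. ?s n x) \<longlonglongrightarrow> indicator (box a b) x *\<^sub>R g x"
      by (intro AE_I2 tendsto_scaleR box_bump_tendsto_indicator tendsto_const)
    show "AE x in lebesgue. norm (?s n x) \<le> norm (indicator (cbox a b) x *\<^sub>R g x)" for n
    proof (rule AE_I2)
      fix x
      show "norm (?s n x) \<le> norm (indicator (cbox a b) x *\<^sub>R g x)"
        using zero[of x n] box_bump_bounds[of a b "real (Suc n)" x]
        by (cases "x \<in> cbox a b") (auto simp: mult_left_le_one_le)
    qed
  qed
  then show ?thesis
    by (simp only: z LIMSEQ_const_iff)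
qed

text \<open>By Lebesgue differentiation almost every value of \<open>g\<close> is a limit of
  averages over small cubes, and these averages vanish by \<open>integral_box_eq_0\<close>.
  Countably many boxes then cover \<open>\<Omega>\<close>.\<close>

lemma AE_eq_0_if_test_integrals_0:
  fixes g :: "'a::euclidean_space \<Rightarrow> 'b::euclidean_space"
  assumes "open \<Omega>" "locally_integrable \<Omega> g"
    and "\<And>\<phi>. \<phi> \<in> test_functions \<Omega> \<Longrightarrow> (\<integral>x. \<phi> x *\<^sub>R g x \<partial>lebesgue_on \<Omega>) = 0"
  shows "AE x in lebesgue_on \<Omega>. g x = 0"
proof -
  have zero: "AE x in lebesgue. x \<in> box c d \<longrightarrow> g x = 0" if sub: "cbox c d \<subseteq> \<Omega>" for c d
  proof -
    \<comment> \<open>The cutoff is integrable on the whole space, as the differentiation theorem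
      wants, and agrees with \<open>g\<close> near every point of the open box.\<close>
    define f where "f = (\<lambda>x. indicator (cbox c d) x *\<^sub>R g x)"
    have "integrable lebesgue f"
      using assms sub by (auto simp: locally_integrable_def set_integrable_def f_def)
    then have si: "set_integrable lebesgue S f" if "S \<in> sets lebesgue" for S
      using that integrable_mult_indicator unfolding set_integrable_def by blast
    have "f integrable_on cbox a b" for a b
      using si[of "cbox a b"] set_lebesgue_integral_eq_integral(1) by auto
    then obtain N where N: "negligible N" "\<And>x e. x \<notin> N \<Longrightarrow> 0 < e \<Longrightarrow>
        \<exists>\<delta>>0. \<forall>h. 0 < h \<and> h < \<delta> \<longrightarrow> norm (integral (cbox x (x + h *\<^sub>R One)) f /\<^sub>R h ^ DIM('a) - f x) < e"
      by (rule integrable_ccontinuous_explicit) auto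
    have "g x = 0" if xN: "x \<notin> N" and xbox: "x \<in> box c d" for x
    proof (rule ccontr)
      assume "g x \<noteq> 0"
      moreover have xcd: "x \<in> cbox c d"
        using xbox box_subset_cbox by blast
      ultimately have "norm (f x) > 0"
        by (simp add: f_def)
      \<comment> \<open>The tolerance is \<open>norm (f x)\<close> itself: an average equal to 0
        would then give \<open>norm (f x) < norm (f x)\<close>.\<close>
      from N(2)[OF xN this] obtain \<delta> where \<delta>: "\<delta> > 0" "\<And>h. 0 < h \<Longrightarrow> h < \<delta> \<Longrightarrow>
          norm (integral (cbox x (x + h *\<^sub>R One)) f /\<^sub>R h ^ DIM('a) - f x) < norm (f x)"
        by blast
      obtain r where r: "r > 0" "ball x r \<subseteq> box c d"
        using xbox open_box open_contains_ball by metis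
      \<comment> \<open>The cube with corner \<open>x\<close> and side \<open>h\<close> has diagonal
        \<open>h * norm One\<close>. The second bound makes this shorter than \<open>r\<close>, so
        that the cube stays in the box.\<close>
      define h where "h = min (\<delta> / 2) (r / (2 * norm (One::'a)))"
      have n1: "norm (One::'a) > 0"
        by simp
      have h: "0 < h" "h < \<delta>" "h * norm (One::'a) < r"
      proof -
        show "0 < h" "h < \<delta>"
          using \<delta>(1) r(1) n1 by (auto simp: h_def)
        have "h \<le> r / (2 * norm (One::'a))"
          by (simp add: h_def)
        then have "h * norm (One::'a) \<le> r / 2"
          using n1 by (simp add: field_simps)
        then show "h * norm (One::'a) < r" using r(1) by simp
      qed
      let ?y = "x + h *\<^sub>R One"
      have "?y \<in> ball x r"
        using h by (simp add: dist_norm)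
      then have "?y \<in> cbox c d" using r box_subset_cbox by blast
      then have sub': "cbox x ?y \<subseteq> cbox c d"
        using xcd by (simp add: subset_box mem_box)
      have "integral (cbox x ?y) f = integral (box x ?y) f"
        by (rule integral_open_interval[symmetric])
      also have "\<dots> = (LINT z:box x ?y|lebesgue. f z)"
        by (intro set_lebesgue_integral_eq_integral(2)[symmetric] si) simp
      also have "\<dots> = (\<integral>z. indicator (box x ?y) z *\<^sub>R g z \<partial>lebesgue)"
        unfolding set_lebesgue_integral_def f_def
      proof (intro Bochner_Integration.integral_cong refl)
        fix z
        show "indicator (box x ?y) z *\<^sub>R indicator (cbox c d) z *\<^sub>R g z = indicator (box x ?y) z *\<^sub>R g z"
          using sub' box_subset_cbox[of x ?y] by (auto simp: indicator_def)
      qed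
      also have "\<dots> = 0"
        using assms sub sub' by (intro integral_box_eq_0[of \<Omega>]) auto
      finally show False
        using \<delta>(2)[of h] h by simp
    qed
    then have "{x \<in> space lebesgue. \<not> (x \<in> box c d \<longrightarrow> g x = 0)} \<subseteq> N"
      by auto
    then show ?thesis
      using N(1) by (auto simp: negligible_iff_null_sets intro: AE_I')
  qed
  obtain D where D: "countable D" "D \<subseteq> Pow \<Omega>" "\<And>X. X \<in> D \<Longrightarrow> \<exists>a b. X = cbox a b" "\<Union>D = \<Omega>"
    by (rule open_countable_Union_open_cbox[OF assms(1)]) blast
  have "AE x in lebesgue. x \<in> X \<longrightarrow> g x = 0" if X: "X \<in> D" for X
  proof -
    obtain a b where ab: "X = cbox a b" using D(3)[OF X] by blast
    \<comment> \<open>The cover consists of closed boxes, while \<open>zero\<close> speaks of open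
      ones; the faces in between are null sets.\<close>
    have "AE x in lebesgue. x \<notin> cbox a b - box a b"
      using negligible_frontier_interval by (intro AE_not_in) (simp add: negligible_iff_null_sets)
    moreover have "AE x in lebesgue. x \<in> box a b \<longrightarrow> g x = 0"
      using X D(2) ab by (intro zero) auto
    ultimately show ?thesis
      unfolding ab by eventually_elim auto
  qed
  then have "AE x in lebesgue. \<forall>X\<in>D. x \<in> X \<longrightarrow> g x = 0"
    using D(1) by (intro AE_ball_countable') auto
  then have "AE x in lebesgue. x \<in> \<Omega> \<longrightarrow> g x = 0"
    by eventually_elim (use D(4) in blast)
  then show ?thesis
    using assms(1) by (simp add: AE_restrict_space_iff)
qed

text \<open>The difference of the two is a weak gradient of the zero function, so its integrals
  against all test functions vanish.\<close>

lemma is_weak_gradient_unique: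
  fixes \<Omega> :: "'a::euclidean_space set"
  assumes "open \<Omega>" "is_weak_gradient \<Omega> v g" "is_weak_gradient \<Omega> v h"
  shows "AE x in lebesgue_on \<Omega>. g x = h x"
proof -
  have "is_weak_gradient \<Omega> (\<lambda>x. 1 * v x + (-1) * v x) (\<lambda>x. 1 *\<^sub>R g x + (-1) *\<^sub>R h x)"
    using assms by (rule is_weak_gradient_lincomb)
  then have "is_weak_gradient \<Omega> (\<lambda>x. 0) (\<lambda>x. g x - h x)"
    by simp
  then have "AE x in lebesgue_on \<Omega>. g x - h x = 0"
    by (intro AE_eq_0_if_test_integrals_0 assms) (auto simp: is_weak_gradient_def)
  then show ?thesis by simp
qed

text \<open>This links the representative picked by \<open>SOME\<close> to any weak gradient that is
  known explicitly.\<close>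

lemma wgrad_AE_eq:
  fixes \<Omega> :: "'a::euclidean_space set"
  assumes "open \<Omega>" "is_weak_gradient \<Omega> v g"
  shows "AE x in lebesgue_on \<Omega>. wgrad \<Omega> v x = g x"
  using is_weak_gradient_unique[OF assms(1) someI[of "is_weak_gradient \<Omega> v", OF assms(2)] assms(2)]
  by (simp only: wgrad_def)


section \<open>Integration by parts for test functions\<close>

lemma lborel_integral_translation:
  fixes F :: "'a::euclidean_space \<Rightarrow> real"
  assumes "F \<in> borel_measurable borel"
  shows "(\<integral>x. F (c + x) \<partial>lborel) = (\<integral>x. F x \<partial>lborel)"
proof -
  have "(\<integral>x. F x \<partial>lborel) = (\<integral>x. F x \<partial>distr lborel borel ((+) c))"
    by (simp add: lborel_distr_plus)
  also have "\<dots> = (\<integral>x. F (c + x) \<partial>lborel)"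
    using assms by (intro integral_distr) auto
  finally show ?thesis ..
qed

text \<open>The integral of \<open>F (x + h b)\<close> does not depend on \<open>h\<close>, so the difference quotients
  have integral zero.\<close>

lemma integral_directional_derivative_eq_0:
  fixes F :: "'a::euclidean_space \<Rightarrow> real"
  assumes K: "compact K" "\<And>x. x \<notin> K \<Longrightarrow> F x = 0"
    and D: "\<And>x. (F has_derivative (\<lambda>h. G x \<bullet> h)) (at x)" "continuous_on UNIV G"
    and "\<And>x. x \<notin> K \<Longrightarrow> G x = 0"
  shows "(\<integral>x. G x \<bullet> b \<partial>lborel) = 0"
proof -
  \<comment> \<open>The steps lie in (0, 1], so all translated supports fit into one ball of radius
    \<open>R + norm b\<close>.\<close>
  define h where "h = (\<lambda>n. inverse (real (Suc n)))"
  have h: "0 < h n" "h n \<le> 1" for n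
    by (auto simp: h_def field_simps)
  have h0: "h \<longlonglongrightarrow> 0"
    unfolding h_def by (rule LIMSEQ_inverse_real_of_nat)
  have contF: "continuous_on UNIV F"
    using D(1) by (intro has_derivative_continuous_on) (rule has_derivative_at_withinI)
  then have measF: "F \<in> borel_measurable borel"
    by (rule borel_measurable_continuous_onI)
  have intF: "integrable lborel F"
  proof -
    have "integrable lborel (\<lambda>x. indicator K x *\<^sub>R F x)"
      using K contF by (intro borel_integrable_compact) (auto intro: continuous_on_subset)
    moreover have "(\<lambda>x. indicator K x *\<^sub>R F x) = F"
      using K(2) by (auto simp: fun_eq_iff indicator_def)
    ultimately show ?thesis by simp
  qed
  have intFt: "integrable lborel (\<lambda>x. F (c + x))" for c
  proof -
    have "integrable (distr lborel borel ((+) c)) F"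
      using intF by (simp add: lborel_distr_plus)
    then show ?thesis
      by (subst (asm) integrable_distr_eq) (use measF in auto)
  qed
  obtain B where B: "B \<ge> 0" "\<And>x. norm (G x) \<le> B"
    using continuous_compact_support_bounded[OF K(1) D(2) assms(5)] by metis
  obtain R where R: "K \<subseteq> cball 0 R"
    using compact_imp_bounded[OF K(1)] by (auto simp: bounded_iff subset_iff)
  have line: "((\<lambda>t. F (x + t *\<^sub>R b)) has_real_derivative G (x + t *\<^sub>R b) \<bullet> b) (at t)" for x t
  proof -
    have "((\<lambda>t. x + t *\<^sub>R b) has_derivative (\<lambda>k. k *\<^sub>R b)) (at t)"
      by (auto intro!: derivative_eq_intros)
    from has_derivative_compose[OF this D(1)[of "x + t *\<^sub>R b"]] show ?thesis
      by (rule has_derivative_imp_has_field_derivative) simp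
  qed
  let ?s = "\<lambda>n x. (F (h n *\<^sub>R b + x) - F x) / h n"
  \<comment> \<open>In the ball the mean value theorem along \<open>b\<close> bounds the quotient;
    outside it \<open>x\<close> and its translate both miss \<open>K\<close>. This is the dominating
    function for the limit below.\<close>
  have bound: "\<bar>?s n x\<bar> \<le> B * norm b * indicator (cball 0 (R + norm b)) x" for n x
  proof (cases "x \<in> cball 0 (R + norm b)")
    case True
    have "\<exists>z>0. z < h n \<and> F (x + h n *\<^sub>R b) - F (x + 0 *\<^sub>R b) = (h n - 0) * (G (x + z *\<^sub>R b) \<bullet> b)"
      by (rule MVT2) (use h line in auto)
    then obtain z where z: "F (x + h n *\<^sub>R b) - F x = h n * (G (x + z *\<^sub>R b) \<bullet> b)"
      by auto
    have "\<bar>G (x + z *\<^sub>R b) \<bullet> b\<bar> \<le> norm (G (x + z *\<^sub>R b)) * norm b"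
      by (rule Cauchy_Schwarz_ineq2)
    also have "\<dots> \<le> B * norm b"
      using B by (intro mult_right_mono) auto
    finally show ?thesis
      using True z h(1)[of n] by (simp add: add.commute)
  next
    case False
    then have "R + norm b < norm x" by simp
    moreover have "norm (h n *\<^sub>R b) \<le> norm b"
      using h[of n] by (simp add: mult_left_le_one_le)
    moreover have "norm x \<le> norm (h n *\<^sub>R b + x) + norm (h n *\<^sub>R b)"
      by (metis add_diff_cancel_left' norm_triangle_ineq4)
    ultimately have "h n *\<^sub>R b + x \<notin> cball 0 R" "x \<notin> cball 0 R"
      using norm_ge_zero[of b] by (auto simp del: norm_ge_zero)
    then have "F (h n *\<^sub>R b + x) = 0" "F x = 0"
      using R K(2) by blast+
    then show ?thesis
      using False by simp
  qed
  have "(\<lambda>n. integral\<^sup>L lborel (?s n)) \<longlonglongrightarrow> (\<integral>x. G x \<bullet> b \<partial>lborel)"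
  proof (rule integral_dominated_convergence)
    show "(\<lambda>x. G x \<bullet> b) \<in> borel_measurable lborel"
      using borel_measurable_continuous_onI[OF D(2)] by simp
    show "?s n \<in> borel_measurable lborel" for n
      using borel_measurable_integrable[OF intFt] borel_measurable_integrable[OF intF]
      by (intro borel_measurable_divide borel_measurable_diff borel_measurable_const) auto
    have "integrable lborel (\<lambda>x. indicator (cball 0 (R + norm b)) x *\<^sub>R (B * norm b))"
      by (intro borel_integrable_compact) auto
    then show "integrable lborel (\<lambda>x. B * norm b * indicator (cball 0 (R + norm b)) x)"
      by (simp add: mult.commute)
    show "AE x in lborel. (\<lambda>n. ?s n x) \<longlonglongrightarrow> G x \<bullet> b"
    proof (rule AE_I2)
      fix x
      have "((\<lambda>k. (F (x + k *\<^sub>R b) - F x) / k) \<longlongrightarrow> G x \<bullet> b) (at 0)"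
        using line[of x 0] by (simp add: DERIV_def)
      moreover have "filterlim h (at 0) sequentially"
        using h0 h(1) by (simp add: filterlim_at less_imp_neq[symmetric])
      ultimately have "(\<lambda>n. (F (x + h n *\<^sub>R b) - F x) / h n) \<longlonglongrightarrow> G x \<bullet> b"
        by (rule filterlim_compose)
      then show "(\<lambda>n. ?s n x) \<longlonglongrightarrow> G x \<bullet> b"
        by (simp add: add.commute)
    qed
    show "AE x in lborel. norm (?s n x) \<le> B * norm b * indicator (cball 0 (R + norm b)) x" for n
      using bound by simp
  qed
  moreover have "integral\<^sup>L lborel (?s n) = 0" for n
    using intF intFt lborel_integral_translation[OF measF] by simp
  ultimately show ?thesis
    by (simp only: LIMSEQ_const_iff)
qed

text \<open>The product of two test functions has compact support, so every directional derivative
  of it integrates to zero; the product rule turns this into the defining identity.\<close>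

lemma is_weak_gradient_test_function:
  fixes \<Omega> :: "'a::euclidean_space set"
  assumes "open \<Omega>" "\<phi> \<in> test_functions \<Omega>"
  shows "is_weak_gradient \<Omega> \<phi> (grad \<phi>)"
proof -
  obtain K where K: "compact K" "K \<subseteq> \<Omega>" "\<And>x. x \<notin> K \<Longrightarrow> \<phi> x = 0" "\<And>x. x \<notin> K \<Longrightarrow> grad \<phi> x = 0"
    "continuous_on UNIV \<phi>" "continuous_on UNIV (grad \<phi>)" "\<And>x. \<phi> differentiable (at x)"
    using assms(2) by (rule test_functionsE) blast
  have li: "locally_integrable \<Omega> \<phi>" "locally_integrable \<Omega> (grad \<phi>)"
    using K(5,6) by (simp_all add: locally_integrable_def continuous_integrable_on_compact)
  have "(\<integral>x. \<phi> x *\<^sub>R grad \<psi> x \<partial>lebesgue_on \<Omega>) = - (\<integral>x. \<psi> x *\<^sub>R grad \<phi> x \<partial>lebesgue_on \<Omega>)"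
    if "\<psi> \<in> test_functions \<Omega>" for \<psi>
  proof -
    have L: "continuous_on UNIV \<psi>" "continuous_on UNIV (grad \<psi>)" "\<And>x. \<psi> differentiable (at x)"
      using that by (rule test_functionsE, blast)+
    have c: "continuous_on UNIV (\<lambda>x. \<phi> x *\<^sub>R grad \<psi> x)" "continuous_on UNIV (\<lambda>x. \<psi> x *\<^sub>R grad \<phi> x)"
      using K L by (intro continuous_intros; simp)+
    have i: "integrable lebesgue (\<lambda>x. \<phi> x *\<^sub>R grad \<psi> x)" "integrable lebesgue (\<lambda>x. \<psi> x *\<^sub>R grad \<phi> x)"
      using K c by (auto intro: continuous_compact_support_integrable[OF K(1)])
    let ?G = "\<lambda>x. \<phi> x *\<^sub>R grad \<psi> x + \<psi> x *\<^sub>R grad \<phi> x"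
    have "(\<integral>x. ?G x \<partial>lebesgue) \<bullet> b = 0" for b
    proof -
      have D: "((\<lambda>x. \<phi> x * \<psi> x) has_derivative (\<lambda>h. ?G x \<bullet> h)) (at x)" for x
        using has_derivative_mult[OF grad_has_derivative[OF K(7)] grad_has_derivative[OF L(3)], of x]
        by (simp add: inner_add_left mult.commute)
      have cG: "continuous_on UNIV ?G"
        using c by (rule continuous_on_add)
      have "(\<integral>x. ?G x \<partial>lebesgue) \<bullet> b = (\<integral>x. ?G x \<bullet> b \<partial>lebesgue)"
        using i by (subst integral_inner_left) auto
      also have "\<dots> = (\<integral>x. ?G x \<bullet> b \<partial>lborel)"
        by (intro integral_completion borel_measurable_inner borel_measurable_const)
          (use borel_measurable_continuous_onI[OF cG] in simp)
      also have "\<dots> = 0"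
        by (rule integral_directional_derivative_eq_0[OF K(1) _ D cG]) (simp_all add: K)
      finally show ?thesis .
    qed
    \<comment> \<open>Take \<open>b\<close> to be the integral itself.\<close>
    then have "(\<integral>x. ?G x \<partial>lebesgue) = 0"
      by (metis inner_eq_zero_iff)
    then have "(\<integral>x. \<phi> x *\<^sub>R grad \<psi> x \<partial>lebesgue) = - (\<integral>x. \<psi> x *\<^sub>R grad \<phi> x \<partial>lebesgue)"
      using i by (simp add: eq_neg_iff_add_eq_0)
    moreover have "\<phi> x *\<^sub>R grad \<psi> x = 0" "\<psi> x *\<^sub>R grad \<phi> x = 0" if "x \<notin> \<Omega>" for x
      using K(2-4) that by auto
    ultimately show ?thesis
      by (simp add: integrable_lebesgue_on_zero_outside(2)[OF assms(1)])
  qed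
  with li show ?thesis
    by (simp add: is_weak_gradient_def)
qed

lemma test_functions_lincomb:
  assumes "\<phi> \<in> test_functions \<Omega>" "\<psi> \<in> test_functions \<Omega>"
  shows "(\<lambda>x. s * \<phi> x + t * \<psi> x) \<in> test_functions \<Omega>"
proof -
  have A: "(\<forall>k. C_k k \<phi>) \<and> compact (closure {x. \<phi> x \<noteq> 0}) \<and> closure {x. \<phi> x \<noteq> 0} \<subseteq> \<Omega>"
    using assms(1) unfolding test_functions_def by (rule CollectD)
  have B: "(\<forall>k. C_k k \<psi>) \<and> compact (closure {x. \<psi> x \<noteq> 0}) \<and> closure {x. \<psi> x \<noteq> 0} \<subseteq> \<Omega>"
    using assms(2) unfolding test_functions_def by (rule CollectD)
  let ?S = "{x. s * \<phi> x + t * \<psi> x \<noteq> 0}" and ?T = "{x. \<phi> x \<noteq> 0} \<union> {x. \<psi> x \<noteq> 0}"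
  have sub: "closure ?S \<subseteq> closure ?T"
    by (rule closure_mono) auto
  have cT: "compact (closure ?T)" and T: "closure ?T \<subseteq> \<Omega>"
    using A B unfolding closure_Un by (simp_all only: compact_Un Un_least)
  have "compact (closure ?S)"
    using compact_Int_closed[OF cT closed_closure[of ?S]] sub by (simp only: Int_absorb1)
  moreover have "closure ?S \<subseteq> \<Omega>"
    using sub T by (rule order_trans)
  moreover have "C_k k (\<lambda>x. s * \<phi> x + t * \<psi> x)" for k
    by (rule C_k_add[OF C_k_mult[OF C_k_const] C_k_mult[OF C_k_const]])
      (rule spec[OF conjunct1[OF A]], rule spec[OF conjunct1[OF B]])
  ultimately show ?thesis
    unfolding test_functions_def by (intro CollectI conjI allI)
qed


section \<open>Linear structure of the Sobolev spaces\<close>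

lemma powr_add_le:
  fixes a b p :: real
  assumes "0 \<le> a" "0 \<le> b" "0 \<le> p"
  shows "(a + b) powr p \<le> 2 powr p * (a powr p + b powr p)"
proof -
  have "(a + b) powr p \<le> (2 * max a b) powr p"
    using assms by (intro powr_mono2) auto
  also have "\<dots> = 2 powr p * max a b powr p"
    using assms by (simp add: powr_mult)
  also have "\<dots> \<le> 2 powr p * (a powr p + b powr p)"
    by (intro mult_left_mono) (auto simp: max_def)
  finally show ?thesis .
qed

lemma Lp_cong_AE:
  fixes f g :: "'a::euclidean_space \<Rightarrow> 'b::euclidean_space"
  assumes "open \<Omega>" "f \<in> Lp \<Omega> p" "AE x in lebesgue_on \<Omega>. f x = g x"
  shows "g \<in> Lp \<Omega> p" "Lp_norm \<Omega> p g = Lp_norm \<Omega> p f"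
proof -
  have f: "f \<in> borel_measurable (lebesgue_on \<Omega>)" "integrable (lebesgue_on \<Omega>) (\<lambda>x. norm (f x) powr p)"
    using assms(2) by (auto simp: Lp_def)
  have \<Omega>: "\<Omega> \<inter> space lebesgue \<in> sets lebesgue"
    using assms(1) by simp
  have "AE x in lebesgue. x \<in> \<Omega> \<longrightarrow> f x = g x"
    using assms(3) by (simp add: AE_restrict_space_iff[OF \<Omega>])
  then have "AE x in lebesgue. indicator \<Omega> x *\<^sub>R f x = indicator \<Omega> x *\<^sub>R g x"
    by eventually_elim (auto simp: indicator_def)
  \<comment> \<open>Lebesgue measure is complete, so changing a measurable function on a null set
    keeps it measurable.\<close>
  then have g: "g \<in> borel_measurable (lebesgue_on \<Omega>)"
    using f(1) borel_measurable_AE[of "\<lambda>x. indicator \<Omega> x *\<^sub>R f x" "\<lambda>x. indicator \<Omega> x *\<^sub>R g x"]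
    unfolding borel_measurable_restrict_space_iff[OF \<Omega>] by blast
  have ae: "AE x in lebesgue_on \<Omega>. norm (f x) powr p = norm (g x) powr p"
    using assms(3) by eventually_elim simp
  have m: "(\<lambda>x. norm (g x) powr p) \<in> borel_measurable (lebesgue_on \<Omega>)"
      "(\<lambda>x. norm (f x) powr p) \<in> borel_measurable (lebesgue_on \<Omega>)"
    using g f(1) by simp_all
  show "g \<in> Lp \<Omega> p"
    using integrable_cong_AE_imp[OF f(2) m(1) ae] g by (simp add: Lp_def)
  show "Lp_norm \<Omega> p g = Lp_norm \<Omega> p f"
    unfolding Lp_norm_def using integral_cong_AE[OF m(2,1) ae] by simp
qed

lemma Lp_norm_nonneg: "0 \<le> Lp_norm \<Omega> p g"
  by (simp add: Lp_norm_def)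

lemma Lp_norm_powr: "p > 0 \<Longrightarrow> Lp_norm \<Omega> p g powr p = (\<integral>x. norm (g x) powr p \<partial>lebesgue_on \<Omega>)"
  by (simp add: Lp_norm_def powr_powr)

text \<open>The factor 4 is a crude form of the triangle inequality: one 2 comes from
  \<open>powr_add_le\<close>, the other from replacing each of two powers by the power of the sum.
  In \<open>W1_0_lincomb\<close> it only has to preserve convergence to zero.\<close>

lemma Lp_lincomb:
  fixes f g :: "'a::euclidean_space \<Rightarrow> 'b::euclidean_space"
  assumes "p \<ge> 1" "f \<in> Lp \<Omega> p" "g \<in> Lp \<Omega> p"
  shows "(\<lambda>x. s *\<^sub>R f x + t *\<^sub>R g x) \<in> Lp \<Omega> p"
    and "Lp_norm \<Omega> p (\<lambda>x. s *\<^sub>R f x + t *\<^sub>R g x) \<le> 4 * (\<bar>s\<bar> * Lp_norm \<Omega> p f + \<bar>t\<bar> * Lp_norm \<Omega> p g)"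
proof -
  let ?M = "lebesgue_on \<Omega>" and ?A = "\<bar>s\<bar> * Lp_norm \<Omega> p f" and ?B = "\<bar>t\<bar> * Lp_norm \<Omega> p g"
  have [measurable]: "f \<in> borel_measurable ?M" "g \<in> borel_measurable ?M"
    and i: "integrable ?M (\<lambda>x. norm (f x) powr p)" "integrable ?M (\<lambda>x. norm (g x) powr p)"
    using assms by (auto simp: Lp_def)
  define H where "H = (\<lambda>x. 2 powr p * (\<bar>s\<bar> powr p * norm (f x) powr p + \<bar>t\<bar> powr p * norm (g x) powr p))"
  have iH: "integrable ?M H"
    unfolding H_def using i by auto
  have le: "norm (s *\<^sub>R f x + t *\<^sub>R g x) powr p \<le> H x" for x
  proof -
    have "norm (s *\<^sub>R f x + t *\<^sub>R g x) powr p \<le> (norm (s *\<^sub>R f x) + norm (t *\<^sub>R g x)) powr p"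
      using assms(1) by (intro powr_mono2 norm_triangle_ineq) auto
    also have "\<dots> \<le> 2 powr p * (norm (s *\<^sub>R f x) powr p + norm (t *\<^sub>R g x) powr p)"
      using assms(1) by (intro powr_add_le) auto
    finally show ?thesis
      by (simp add: H_def powr_mult)
  qed
  have i': "integrable ?M (\<lambda>x. norm (s *\<^sub>R f x + t *\<^sub>R g x) powr p)"
    by (rule Bochner_Integration.integrable_bound[OF iH]) (use le in \<open>auto intro: order_trans[OF _ abs_ge_self]\<close>)
  then show "(\<lambda>x. s *\<^sub>R f x + t *\<^sub>R g x) \<in> Lp \<Omega> p"
    by (simp add: Lp_def)
  have "(\<integral>x. norm (s *\<^sub>R f x + t *\<^sub>R g x) powr p \<partial>?M) \<le> (\<integral>x. H x \<partial>?M)"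
    using i' iH le by (rule integral_mono)
  also have "\<dots> = 2 powr p * (?A powr p + ?B powr p)"
    using i assms(1) by (simp add: H_def powr_mult Lp_norm_nonneg Lp_norm_powr)
  also have "\<dots> \<le> 2 powr p * ((?A + ?B) powr p + (?A + ?B) powr p)"
    using assms(1) by (intro mult_left_mono add_mono powr_mono2) (auto simp: Lp_norm_nonneg)
  \<comment> \<open>The doubling is raised from \<open>2 powr 1\<close> to \<open>2 powr p\<close>,
    which makes the whole bound a single \<open>p\<close>-th power.\<close>
  also have "\<dots> = 2 powr p * (2 powr 1 * (?A + ?B) powr p)"
    by simp
  also have "\<dots> \<le> 2 powr p * (2 powr p * (?A + ?B) powr p)"
    using assms(1) by (intro mult_left_mono mult_right_mono powr_mono) auto
  also have "\<dots> = (2 * (2 * (?A + ?B))) powr p"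
  proof -
    have "0 \<le> ?A + ?B" by (simp add: Lp_norm_nonneg)
    then show ?thesis by (simp only: powr_mult mult_nonneg_nonneg zero_le_numeral)
  qed
  finally have "(\<integral>x. norm (s *\<^sub>R f x + t *\<^sub>R g x) powr p \<partial>?M) \<le> (4 * (?A + ?B)) powr p"
    by simp
  then have "Lp_norm \<Omega> p (\<lambda>x. s *\<^sub>R f x + t *\<^sub>R g x) \<le> ((4 * (?A + ?B)) powr p) powr (1 / p)"
    unfolding Lp_norm_def using assms(1) by (intro powr_mono2) auto
  also have "\<dots> = 4 * (?A + ?B)"
    using assms(1) by (simp add: powr_powr Lp_norm_nonneg)
  finally show "Lp_norm \<Omega> p (\<lambda>x. s *\<^sub>R f x + t *\<^sub>R g x) \<le> 4 * (?A + ?B)" .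
qed

lemma continuous_compact_support_Lp:
  fixes \<psi> :: "'a::euclidean_space \<Rightarrow> 'b::euclidean_space"
  assumes "open \<Omega>" "p > 0" "compact K" "K \<subseteq> \<Omega>" "continuous_on UNIV \<psi>" "\<And>x. x \<notin> K \<Longrightarrow> \<psi> x = 0"
  shows "\<psi> \<in> Lp \<Omega> p"
proof -
  have "continuous_on UNIV (\<lambda>x. norm (\<psi> x) powr p)"
    using assms by (intro continuous_on_powr' continuous_intros) auto
  then have "integrable lebesgue (\<lambda>x. norm (\<psi> x) powr p)"
    using assms by (intro continuous_compact_support_integrable[of K]) auto
  then have "integrable (lebesgue_on \<Omega>) (\<lambda>x. norm (\<psi> x) powr p)"
    using assms by (subst integrable_lebesgue_on_zero_outside(1)) auto
  moreover have "\<psi> \<in> borel_measurable (lebesgue_on \<Omega>)"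
    using assms continuous_on_borel_measurable_lebesgue measurable_restrict_space1 by blast
  ultimately show ?thesis
    by (simp add: Lp_def)
qed

lemma test_function_W1:
  fixes \<Omega> :: "'a::euclidean_space set"
  assumes "open \<Omega>" "p > 0" "\<phi> \<in> test_functions \<Omega>"
  shows "\<phi> \<in> W1 \<Omega> p"
proof -
  obtain K where K: "compact K" "K \<subseteq> \<Omega>" "\<And>x. x \<notin> K \<Longrightarrow> \<phi> x = 0" "\<And>x. x \<notin> K \<Longrightarrow> grad \<phi> x = 0"
    "continuous_on UNIV \<phi>" "continuous_on UNIV (grad \<phi>)" "\<And>x. \<phi> differentiable (at x)"
    using assms(3) by (rule test_functionsE) blast
  have "\<phi> \<in> Lp \<Omega> p"
    by (rule continuous_compact_support_Lp[OF assms(1,2) K(1,2,5,3)])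
  moreover have "grad \<phi> \<in> Lp \<Omega> p"
    by (rule continuous_compact_support_Lp[OF assms(1,2) K(1,2,6,4)])
  moreover note is_weak_gradient_test_function[OF assms(1,3)]
  ultimately show ?thesis
    by (auto simp: W1_def)
qed

text \<open>Membership in \<open>W1\<close> provides some weak gradient in \<open>Lp\<close>,
  whereas \<open>wgrad\<close> may pick another one; uniqueness carries the integrability
  over.\<close>

lemma W1_wgrad:
  fixes \<Omega> :: "'a::euclidean_space set"
  assumes "open \<Omega>" "v \<in> W1 \<Omega> p"
  shows "is_weak_gradient \<Omega> v (wgrad \<Omega> v)" "wgrad \<Omega> v \<in> Lp \<Omega> p"
proof -
  obtain g where g: "g \<in> Lp \<Omega> p" "is_weak_gradient \<Omega> v g"
    using assms by (auto simp: W1_def)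
  show "is_weak_gradient \<Omega> v (wgrad \<Omega> v)"
    unfolding wgrad_def using someI[of "is_weak_gradient \<Omega> v", OF g(2)] .
  have "AE x in lebesgue_on \<Omega>. g x = wgrad \<Omega> v x"
    using wgrad_AE_eq[OF assms(1) g(2)] by eventually_elim simp
  then show "wgrad \<Omega> v \<in> Lp \<Omega> p"
    by (rule Lp_cong_AE[OF assms(1) g(1)])
qed

lemma wgrad_lincomb:
  fixes \<Omega> :: "'a::euclidean_space set"
  assumes "open \<Omega>" "v \<in> W1 \<Omega> p" "w \<in> W1 \<Omega> p"
  shows "AE x in lebesgue_on \<Omega>.
    wgrad \<Omega> (\<lambda>x. s * v x + t * w x) x = s *\<^sub>R wgrad \<Omega> v x + t *\<^sub>R wgrad \<Omega> w x"
  by (intro wgrad_AE_eq is_weak_gradient_lincomb W1_wgrad(1)[where p = p] assms)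

lemma W1_lincomb:
  fixes \<Omega> :: "'a::euclidean_space set"
  assumes "open \<Omega>" "p \<ge> 1" "v \<in> W1 \<Omega> p" "w \<in> W1 \<Omega> p"
  shows "(\<lambda>x. s * v x + t * w x) \<in> W1 \<Omega> p"
    and "W1_norm \<Omega> p (\<lambda>x. s * v x + t * w x) \<le> 4 * (\<bar>s\<bar> * W1_norm \<Omega> p v + \<bar>t\<bar> * W1_norm \<Omega> p w)"
proof -
  let ?g = "\<lambda>x. s *\<^sub>R wgrad \<Omega> v x + t *\<^sub>R wgrad \<Omega> w x"
  note g = W1_wgrad[OF assms(1,3)] W1_wgrad[OF assms(1,4)]
  have v: "v \<in> Lp \<Omega> p" "w \<in> Lp \<Omega> p"
    using assms by (auto simp: W1_def)
  note L = Lp_lincomb[OF assms(2) v, of s t] Lp_lincomb[OF assms(2) g(2,4), of s t]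
  show "(\<lambda>x. s * v x + t * w x) \<in> W1 \<Omega> p"
    using L is_weak_gradient_lincomb[OF assms(1) g(1,3), of s t] by (auto simp: W1_def)
  have "AE x in lebesgue_on \<Omega>. ?g x = wgrad \<Omega> (\<lambda>x. s * v x + t * w x) x"
    using wgrad_lincomb[OF assms(1,3,4), of s t] by eventually_elim simp
  then have "Lp_norm \<Omega> p (wgrad \<Omega> (\<lambda>x. s * v x + t * w x)) = Lp_norm \<Omega> p ?g"
    by (rule Lp_cong_AE(2)[OF assms(1) L(3)])
  then show "W1_norm \<Omega> p (\<lambda>x. s * v x + t * w x) \<le> 4 * (\<bar>s\<bar> * W1_norm \<Omega> p v + \<bar>t\<bar> * W1_norm \<Omega> p w)"
    using L(2,4) by (simp add: W1_norm_def algebra_simps)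
qed

lemma W1_norm_nonneg: "0 \<le> W1_norm \<Omega> p v"
  by (simp add: W1_norm_def Lp_norm_nonneg)

lemma W1_0_lincomb:
  fixes \<Omega> :: "'a::euclidean_space set"
  assumes "open \<Omega>" "p \<ge> 1" "v \<in> W1_0 \<Omega> p" "w \<in> W1_0 \<Omega> p"
  shows "(\<lambda>x. s * v x + t * w x) \<in> W1_0 \<Omega> p"
proof -
  have vw: "v \<in> W1 \<Omega> p" "w \<in> W1 \<Omega> p"
    using assms by (auto simp: W1_0_def)
  obtain \<phi> where \<phi>: "\<And>n::nat. \<phi> n \<in> test_functions \<Omega>"
    "(\<lambda>n. W1_norm \<Omega> p (\<lambda>x. v x - \<phi> n x)) \<longlonglongrightarrow> 0"
    using assms(3) unfolding W1_0_def by blast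
  obtain \<psi> where \<psi>: "\<And>n::nat. \<psi> n \<in> test_functions \<Omega>"
    "(\<lambda>n. W1_norm \<Omega> p (\<lambda>x. w x - \<psi> n x)) \<longlonglongrightarrow> 0"
    using assms(4) unfolding W1_0_def by blast
  let ?\<chi> = "\<lambda>n x. s * \<phi> n x + t * \<psi> n x"
  \<comment> \<open>The norm estimate for linear combinations applies to members of
    \<open>W1\<close>, so the approximation errors have to be placed there first.\<close>
  have W: "(\<lambda>x. v x - \<phi> n x) \<in> W1 \<Omega> p" "(\<lambda>x. w x - \<psi> n x) \<in> W1 \<Omega> p" for n
    using W1_lincomb(1)[OF assms(1,2) vw(1) test_function_W1[OF assms(1) _ \<phi>(1)], of 1 "-1"]
      W1_lincomb(1)[OF assms(1,2) vw(2) test_function_W1[OF assms(1) _ \<psi>(1)], of 1 "-1"] assms(2)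
    by auto
  have "(\<lambda>n. W1_norm \<Omega> p (\<lambda>x. (s * v x + t * w x) - ?\<chi> n x)) \<longlonglongrightarrow> 0"
  proof (rule tendsto_sandwich)
    show "\<forall>\<^sub>F n in sequentially. 0 \<le> W1_norm \<Omega> p (\<lambda>x. (s * v x + t * w x) - ?\<chi> n x)"
      by (simp add: W1_norm_nonneg)
    have "W1_norm \<Omega> p (\<lambda>x. (s * v x + t * w x) - ?\<chi> n x)
        \<le> 4 * (\<bar>s\<bar> * W1_norm \<Omega> p (\<lambda>x. v x - \<phi> n x) + \<bar>t\<bar> * W1_norm \<Omega> p (\<lambda>x. w x - \<psi> n x))" for n
      using W1_lincomb(2)[OF assms(1,2) W, of s n t] by (simp add: algebra_simps)
    then show "\<forall>\<^sub>F n in sequentially. W1_norm \<Omega> p (\<lambda>x. (s * v x + t * w x) - ?\<chi> n x)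
        \<le> 4 * (\<bar>s\<bar> * W1_norm \<Omega> p (\<lambda>x. v x - \<phi> n x) + \<bar>t\<bar> * W1_norm \<Omega> p (\<lambda>x. w x - \<psi> n x))"
      by simp
    show "(\<lambda>n. 4 * (\<bar>s\<bar> * W1_norm \<Omega> p (\<lambda>x. v x - \<phi> n x)
        + \<bar>t\<bar> * W1_norm \<Omega> p (\<lambda>x. w x - \<psi> n x))) \<longlonglongrightarrow> 0"
      by (auto intro!: tendsto_eq_intros \<phi>(2) \<psi>(2))
  qed simp
  moreover have "?\<chi> n \<in> test_functions \<Omega>" for n
    by (intro test_functions_lincomb \<phi> \<psi>)
  moreover note W1_lincomb(1)[OF assms(1,2) vw]
  ultimately show ?thesis
    unfolding W1_0_def by (intro CollectI conjI exI[of _ ?\<chi>] allI)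
qed


section \<open>Energy estimates\<close>

text \<open>After division by \<open>a + b\<close> both terms lie in [0, 1], where
  \<open>t \<le> t powr q\<close>.\<close>

lemma powr_add_le_subadditive:
  fixes a b q :: real
  assumes "0 \<le> a" "0 \<le> b" "0 < q" "q \<le> 1"
  shows "(a + b) powr q \<le> a powr q + b powr q"
proof (cases "a + b = 0")
  case True
  then show ?thesis using assms by simp
next
  case False
  define S where "S = a + b"
  have S: "S > 0" using False assms by (simp add: S_def)
  have le: "x / S \<le> (x / S) powr q" if "0 \<le> x" "x \<le> S" for x
  proof (cases "x = 0")
    case False
    then have xS: "0 < x / S" "x / S \<le> 1" using that S by auto
    then have "(x / S) powr 1 \<le> (x / S) powr q"
      using assms by (intro powr_mono') auto
    then show ?thesis
      using xS(1) by (simp only: powr_one)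
  qed simp
  have "1 = a / S + b / S"
    using S by (simp add: S_def add_divide_distrib[symmetric])
  also have "\<dots> \<le> (a / S) powr q + (b / S) powr q"
    using assms by (intro add_mono le) (auto simp: S_def)
  also have "\<dots> = (a powr q + b powr q) / S powr q"
    using assms S by (simp add: powr_divide add_divide_distrib)
  finally show ?thesis
    using S by (simp add: S_def field_simps)
qed

text \<open>The tangent line of the concave power at the midpoint \<open>m\<close> lies above it. In
  the form of Young's inequality this is applied at \<open>x\<close> and at \<open>y\<close>, and
  the two bounds add up to \<open>2 * m\<close>.\<close>

lemma powr_half_concave:
  fixes x y q :: real
  assumes "0 \<le> x" "0 \<le> y" "0 < q" "q \<le> 1"
  shows "x powr q + y powr q \<le> 2 * ((x + y) / 2) powr q"
proof (cases "x = 0 \<or> y = 0")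
  case True
  \<comment> \<open>Young's inequality is used for positive numbers only. If one of them is 0, the
    claim reduces to \<open>2 powr q \<le> 2\<close>.\<close>
  have "z powr q \<le> 2 * (z / 2) powr q" if "0 \<le> z" for z
  proof -
    have "2 powr q \<le> (2::real) powr 1"
      using assms by (intro powr_mono) auto
    then have "2 powr q * (z / 2) powr q \<le> 2 * (z / 2) powr q"
      by (intro mult_right_mono) auto
    moreover have "2 powr q * (z / 2) powr q = z powr q"
      using that by (simp add: powr_mult[symmetric])
    ultimately show ?thesis by simp
  qed
  with True assms show ?thesis by auto
next
  case False
  then have pos: "0 < x" "0 < y" using assms by auto
  define m where "m = (x + y) / 2"
  have m: "m > 0" using pos by (simp add: m_def)
  have "(x powr q + y powr q) * m powr (1 - q) \<le> (q * x + (1 - q) * m) + (q * y + (1 - q) * m)"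
    unfolding distrib_right[of _ _ "m powr (1 - q)"] using assms pos m by (intro add_mono Youngs_inequality_0) auto
  also have "\<dots> = 2 * m"
    by (simp add: m_def field_simps)
  also have "\<dots> = 2 * m powr q * m powr (1 - q)"
    using m by (simp add: powr_add[symmetric])
  finally have "x powr q + y powr q \<le> 2 * m powr q"
    using m by (simp only: mult_le_cancel_right powr_gt_zero)
  then show ?thesis by (simp only: m_def)
qed

text \<open>The parallelogram identity combined with the concavity and subadditivity of
  \<open>s \<mapsto> s powr (p / 2)\<close>.\<close>

lemma norm_powr_parallelogram:
  fixes a h :: "'a::real_inner"
  assumes "0 < p" "p \<le> 2"
  shows "norm (a + h) powr p + norm (a - h) powr p \<le> 2 * norm a powr p + 2 * norm h powr p"
proof -
  \<comment> \<open>Writing powers of norms as powers of squares with exponent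
    \<open>p / 2 \<le> 1\<close> lets the parallelogram identity enter.\<close>
  have sq: "(norm z ^ 2) powr (p / 2) = norm z powr p" for z :: 'a
    by (simp add: powr_powr flip: powr_numeral)
  have "norm (a + h) powr p + norm (a - h) powr p
      = (norm (a + h) ^ 2) powr (p / 2) + (norm (a - h) ^ 2) powr (p / 2)"
    by (simp only: sq)
  also have "\<dots> \<le> 2 * ((norm (a + h) ^ 2 + norm (a - h) ^ 2) / 2) powr (p / 2)"
    using assms by (intro powr_half_concave) auto
  also have "(norm (a + h) ^ 2 + norm (a - h) ^ 2) / 2 = norm a ^ 2 + norm h ^ 2"
    by (simp add: power2_norm_eq_inner algebra_simps inner_commute)
  also have "2 * (norm a ^ 2 + norm h ^ 2) powr (p / 2)
      \<le> 2 * ((norm a ^ 2) powr (p / 2) + (norm h ^ 2) powr (p / 2))"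
    using assms by (intro mult_left_mono powr_add_le_subadditive) auto
  finally show ?thesis
    by (simp only: sq distrib_left)
qed

section \<open>Relaxed energy against energy, and the energy gap at a minimizer\<close>

text \<open>Below \<open>em\<close> the quadratic branch is largest at \<open>t = em\<close>, where
  its value is \<open>em powr p / p\<close>; between \<open>em\<close> and \<open>ep\<close> the
  function is the pure power.\<close>

lemma kappa_le:
  assumes "0 < p" "p \<le> 2" "0 < em" "0 \<le> t" "t \<le> ep"
  shows "kappa p em ep t \<le> 1 / p * t powr p + 1 / p * em powr p"
proof (cases "t \<le> em")
  case True
  have "em powr (p - 2) * t\<^sup>2 \<le> em powr (p - 2) * em\<^sup>2"
    using True assms by (intro mult_left_mono power_mono) auto
  also have "\<dots> = em powr p"
    using assms by (simp add: powr_diff)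
  finally have "kappa p em ep t \<le> 1 / p * em powr p"
    using True by (simp add: kappa_def algebra_simps)
  also have "\<dots> \<le> 1 / p * t powr p + 1 / p * em powr p"
    using assms by simp
  finally show ?thesis .
next
  case False
  then show ?thesis
    using assms by (simp add: kappa_def)
qed

text \<open>Integrate \<open>kappa_le\<close> over \<open>\<Omega>\<close>; its constant term
  contributes the measure of \<open>\<Omega>\<close>, finite by boundedness.\<close>

lemma relaxed_energy_le_energy:
  fixes \<Omega> :: "'a::euclidean_space set"
  assumes "open \<Omega>" "bounded \<Omega>" "1 < p" "p < 2" "0 < em"
    and v: "v \<in> W1 \<Omega> p" and "AE x in lebesgue_on \<Omega>. norm (wgrad \<Omega> v x) \<le> ep"
  shows "relaxed_energy \<Omega> p f em ep v
    \<le> ereal (energy \<Omega> p f v + measure lebesgue \<Omega> / p * em powr p)"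
proof -
  let ?M = "lebesgue_on \<Omega>" and ?n = "\<lambda>x. norm (wgrad \<Omega> v x) powr p"
  have i: "integrable ?M ?n"
    using W1_wgrad(2)[OF assms(1) v] by (simp add: Lp_def)
  have fin: "\<Omega> \<in> lmeasurable"
    using assms by (simp add: lmeasurable_open)
  have sp: "measure ?M (space ?M) = measure lebesgue \<Omega>"
    using assms(1) by (simp add: measure_restrict_space)
  interpret finite_measure ?M
    using fin by (rule finite_measure_lebesgue_on)
  let ?H = "\<lambda>x. 1 / p * ?n x + 1 / p * em powr p"
  have iH: "integrable ?M ?H"
    using i by simp
  \<comment> \<open>Nonnegativity makes the passage from \<open>ennreal\<close> to
    \<open>ereal\<close> faithful, since \<open>ennreal\<close> truncates negative numbers to
    0.\<close>
  have c: "0 \<le> 1 / p * (\<integral>x. ?n x \<partial>?M) + measure lebesgue \<Omega> / p * em powr p"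
    using assms by (intro add_nonneg_nonneg mult_nonneg_nonneg integral_nonneg_AE) auto
  have "(\<integral>\<^sup>+x. ennreal (kappa p em ep (norm (wgrad \<Omega> v x))) \<partial>?M) \<le> (\<integral>\<^sup>+x. ennreal (?H x) \<partial>?M)"
    using assms(7)
  proof (intro nn_integral_mono_AE, eventually_elim)
    case (elim x)
    show ?case
      using elim assms(3-5) by (intro ennreal_leI kappa_le) auto
  qed
  also have "\<dots> = ennreal (\<integral>x. ?H x \<partial>?M)"
    using iH assms by (intro nn_integral_eq_integral) auto
  also have "(\<integral>x. ?H x \<partial>?M) = 1 / p * (\<integral>x. ?n x \<partial>?M) + measure lebesgue \<Omega> / p * em powr p"
    using i sp by simp
  finally have "enn2ereal (\<integral>\<^sup>+x. ennreal (kappa p em ep (norm (wgrad \<Omega> v x))) \<partial>?M)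
      \<le> ereal (1 / p * (\<integral>x. ?n x \<partial>?M) + measure lebesgue \<Omega> / p * em powr p)"
    using assms by (simp only: less_eq_ennreal.rep_eq enn2ereal_ennreal c)
  then have "relaxed_energy \<Omega> p f em ep v
      \<le> ereal (1 / p * (\<integral>x. ?n x \<partial>?M) + measure lebesgue \<Omega> / p * em powr p) - ereal (f v)"
    unfolding relaxed_energy_def by (rule ereal_minus_mono) simp
  then show ?thesis
    by (simp add: energy_def algebra_simps)
qed

lemma energy_parallelogram:
  fixes \<Omega> :: "'a::euclidean_space set"
  assumes "open \<Omega>" "1 < p" "p < 2" "f \<in> W1_0_dual \<Omega> p" "u \<in> W1_0 \<Omega> p" "k \<in> W1_0 \<Omega> p"
  shows "energy \<Omega> p f (\<lambda>x. u x + k x) + energy \<Omega> p f (\<lambda>x. u x - k x)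
    \<le> 2 * energy \<Omega> p f u + 2 / p * (\<integral>x. norm (wgrad \<Omega> k x) powr p \<partial>lebesgue_on \<Omega>)"
proof -
  let ?M = "lebesgue_on \<Omega>" and ?n = "\<lambda>v x. norm (wgrad \<Omega> v x) powr p"
  have W: "u \<in> W1 \<Omega> p" "k \<in> W1 \<Omega> p"
    using assms by (auto simp: W1_0_def)
  have pm0: "(\<lambda>x. u x + k x) \<in> W1_0 \<Omega> p" "(\<lambda>x. u x - k x) \<in> W1_0 \<Omega> p"
    using W1_0_lincomb[OF assms(1) _ assms(5,6), of 1 1]
      W1_0_lincomb[OF assms(1) _ assms(5,6), of 1 "-1"] assms(2) by auto
  then have pm: "(\<lambda>x. u x + k x) \<in> W1 \<Omega> p" "(\<lambda>x. u x - k x) \<in> W1 \<Omega> p"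
    by (auto simp: W1_0_def)
  have i: "integrable ?M (?n v)" if "v \<in> W1 \<Omega> p" for v
    using W1_wgrad(2)[OF assms(1) that] by (simp add: Lp_def)
  have "AE x in ?M. ?n (\<lambda>x. u x + k x) x + ?n (\<lambda>x. u x - k x) x \<le> 2 * ?n u x + 2 * ?n k x"
    using wgrad_lincomb[OF assms(1) W, of 1 1] wgrad_lincomb[OF assms(1) W, of 1 "-1"]
  proof eventually_elim
    case (elim x)
    then show ?case
      using norm_powr_parallelogram[of p "wgrad \<Omega> u x" "wgrad \<Omega> k x"] assms by simp
  qed
  then have "(\<integral>x. ?n (\<lambda>x. u x + k x) x + ?n (\<lambda>x. u x - k x) x \<partial>?M) \<le> (\<integral>x. 2 * ?n u x + 2 * ?n k x \<partial>?M)"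
    using i W pm by (intro integral_mono_AE) auto
  then have "(\<integral>x. ?n (\<lambda>x. u x + k x) x \<partial>?M) + (\<integral>x. ?n (\<lambda>x. u x - k x) x \<partial>?M)
      \<le> 2 * (\<integral>x. ?n u x \<partial>?M) + 2 * (\<integral>x. ?n k x \<partial>?M)"
    using i W pm by simp
  then have "1 / p * ((\<integral>x. ?n (\<lambda>x. u x + k x) x \<partial>?M) + (\<integral>x. ?n (\<lambda>x. u x - k x) x \<partial>?M))
      \<le> 1 / p * (2 * (\<integral>x. ?n u x \<partial>?M) + 2 * (\<integral>x. ?n k x \<partial>?M))"
    using assms by (intro mult_left_mono) auto
  \<comment> \<open>Additivity suffices: \<open>u\<close> is the sum of \<open>u - k\<close> and
    \<open>k\<close>, which expresses \<open>f\<close> at \<open>u - k\<close> as a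
    difference.\<close>
  moreover have "f (\<lambda>x. u x + k x) + f (\<lambda>x. u x - k x) = 2 * f u"
  proof -
    have add: "f (\<lambda>x. v x + w x) = f v + f w" if "v \<in> W1_0 \<Omega> p" "w \<in> W1_0 \<Omega> p" for v w
      using assms(4) that by (simp add: W1_0_dual_def)
    have "f (\<lambda>x. u x + k x) = f u + f k"
      using assms by (intro add)
    moreover have "f (\<lambda>x. (u x - k x) + k x) = f (\<lambda>x. u x - k x) + f k"
      using assms pm0 by (intro add)
    ultimately show ?thesis by simp
  qed
  ultimately show ?thesis
    unfolding energy_def by (simp add: distrib_left)
qed

text \<open>With \<open>k = u - w\<close> the competitor is the reflection
  \<open>u + k = 2 * u - w\<close>. Its energy is at least that of \<open>u\<close>, and removing it
  from the parallelogram estimate leaves a bound for \<open>u - k = w\<close>.\<close>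

lemma energy_minimizer_gap:
  fixes \<Omega> :: "'a::euclidean_space set"
  assumes "open \<Omega>" "1 < p" "p < 2" "f \<in> W1_0_dual \<Omega> p"
    and min: "is_arg_min (energy \<Omega> p f) (\<lambda>v. v \<in> W1_0 \<Omega> p) u" and w: "w \<in> W1_0 \<Omega> p"
  shows "energy \<Omega> p f w - energy \<Omega> p f u
    \<le> 2 / p * (\<integral>x. norm (wgrad \<Omega> (\<lambda>x. u x - w x) x) powr p \<partial>lebesgue_on \<Omega>)"
proof -
  have u: "u \<in> W1_0 \<Omega> p"
    using min by (simp add: is_arg_min_def)
  have k: "(\<lambda>x. u x - w x) \<in> W1_0 \<Omega> p"
    using W1_0_lincomb[OF assms(1) _ u w, of 1 "-1"] assms(2) by auto
  have "(\<lambda>x. u x + (u x - w x)) \<in> W1_0 \<Omega> p"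
    using W1_0_lincomb[OF assms(1) _ u k, of 1 1] assms(2) by auto
  then have "energy \<Omega> p f u \<le> energy \<Omega> p f (\<lambda>x. u x + (u x - w x))"
    using min by (auto simp: is_arg_min_def not_less)
  then show ?thesis
    using energy_parallelogram[OF assms(1-4) u k] by simp
qed


section \<open>Comparison with the Lipschitz truncation of the minimizer\<close>

theorem theorem5:
  fixes \<Omega> :: "'a::euclidean_space set" and p c1 :: real
  assumes "open \<Omega>" and "bounded \<Omega>"
    and "1 < p" and "p < 2"
    and "c1 > 0" and "\<exists>c T. lipschitz_truncation \<Omega> p c1 c T"
  shows "\<exists>C>0. \<forall>f\<in>W1_0_dual \<Omega> p. \<forall>em ep l u ue.
    0 < em \<longrightarrow> em \<le> ep \<longrightarrow> 0 < l \<longrightarrow> l \<le> ep / c1 \<longrightarrow>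
    is_arg_min (energy \<Omega> p f) (\<lambda>v. v \<in> W1_0 \<Omega> p) u \<longrightarrow>
    is_arg_min (relaxed_energy \<Omega> p f em ep) (\<lambda>v. v \<in> W1_0 \<Omega> p) ue \<longrightarrow>
    relaxed_energy \<Omega> p f em ep ue - ereal (energy \<Omega> p f u)
      \<le> ereal (C * (em powr p +
          (\<integral>x. norm (wgrad \<Omega> u x) powr p \<partial>lebesgue_on (bad_set \<Omega> u l))))"
proof -
  obtain c T where T: "lipschitz_truncation \<Omega> p c1 c T"
    using assms(6) by blast
  \<comment> \<open>The summand 1 secures positivity; the other two are the factors of
    \<open>em powr p\<close> and of the bad-set integral. The absolute value is taken because
    \<open>lipschitz_truncation\<close> leaves the sign of \<open>c\<close> open.\<close>
  define C where "C = 1 + measure lebesgue \<Omega> / p + 2 / p * \<bar>c\<bar> powr p"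
  have C: "C > 0" "measure lebesgue \<Omega> / p \<le> C" "2 / p * \<bar>c\<bar> powr p \<le> C"
  proof -
    have "0 \<le> measure lebesgue \<Omega> / p" "0 \<le> 2 / p * \<bar>c\<bar> powr p"
      using assms(3) by simp_all
    then show "C > 0" "measure lebesgue \<Omega> / p \<le> C" "2 / p * \<bar>c\<bar> powr p \<le> C"
      by (simp_all only: C_def)
  qed
  have "relaxed_energy \<Omega> p f em ep ue - ereal (energy \<Omega> p f u)
      \<le> ereal (C * (em powr p + (\<integral>x. norm (wgrad \<Omega> u x) powr p \<partial>lebesgue_on (bad_set \<Omega> u l))))"
    if f: "f \<in> W1_0_dual \<Omega> p" and "0 < em" "0 < l" "l \<le> ep / c1"
      and u: "is_arg_min (energy \<Omega> p f) (\<lambda>v. v \<in> W1_0 \<Omega> p) u"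
      and ue: "is_arg_min (relaxed_energy \<Omega> p f em ep) (\<lambda>v. v \<in> W1_0 \<Omega> p) ue"
    for f em ep l u ue
  proof -
    let ?w = "T l u" and ?I = "\<integral>x. norm (wgrad \<Omega> u x) powr p \<partial>lebesgue_on (bad_set \<Omega> u l)"
    have u0: "u \<in> W1_0 \<Omega> p"
      using u by (simp add: is_arg_min_def)
    have w0: "?w \<in> W1_0 \<Omega> p"
      and wle: "AE x in lebesgue_on \<Omega>. norm (wgrad \<Omega> ?w x) \<le> c1 * l"
      and diff: "Lp_norm \<Omega> p (wgrad \<Omega> (\<lambda>x. u x - ?w x)) \<le> c * Lp_norm (bad_set \<Omega> u l) p (wgrad \<Omega> u)"
      using T u0 \<open>0 < l\<close> unfolding lipschitz_truncation_def by blast+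
    \<comment> \<open>The upper bound on \<open>l\<close> keeps the gradient of the truncation out
      of the range above \<open>ep\<close>, where \<open>kappa\<close> is quadratic again.\<close>
    have "c1 * l \<le> ep"
      using \<open>l \<le> ep / c1\<close> assms(5) by (simp add: field_simps)
    with wle have wep: "AE x in lebesgue_on \<Omega>. norm (wgrad \<Omega> ?w x) \<le> ep"
      by (auto elim!: eventually_mono)
    have "(\<integral>x. norm (wgrad \<Omega> (\<lambda>x. u x - ?w x) x) powr p \<partial>lebesgue_on \<Omega>)
        = Lp_norm \<Omega> p (wgrad \<Omega> (\<lambda>x. u x - ?w x)) powr p"
      using assms(3) by (simp add: Lp_norm_powr)
    also have "\<dots> \<le> (\<bar>c\<bar> * Lp_norm (bad_set \<Omega> u l) p (wgrad \<Omega> u)) powr p"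
      using assms(3)
      by (intro powr_mono2 order_trans[OF diff] mult_right_mono) (auto simp: Lp_norm_nonneg)
    also have "\<dots> = \<bar>c\<bar> powr p * ?I"
      using assms(3) by (simp add: powr_mult Lp_norm_nonneg Lp_norm_powr)
    finally have "2 / p * (\<integral>x. norm (wgrad \<Omega> (\<lambda>x. u x - ?w x) x) powr p \<partial>lebesgue_on \<Omega>)
        \<le> 2 / p * (\<bar>c\<bar> powr p * ?I)"
      using assms(3) by (intro mult_left_mono) auto
    then have gap: "energy \<Omega> p f ?w \<le> energy \<Omega> p f u + 2 / p * \<bar>c\<bar> powr p * ?I"
      using energy_minimizer_gap[OF assms(1,3,4) f u w0] by (simp add: mult.assoc)
    \<comment> \<open>The truncation is an admissible competitor for the relaxed problem.\<close>
    have "relaxed_energy \<Omega> p f em ep ue \<le> relaxed_energy \<Omega> p f em ep ?w"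
      using ue w0 by (auto simp: is_arg_min_def not_less)
    also have "\<dots> \<le> ereal (energy \<Omega> p f ?w + measure lebesgue \<Omega> / p * em powr p)"
      using relaxed_energy_le_energy[OF assms(1-4) \<open>0 < em\<close> _ wep] w0 by (simp add: W1_0_def)
    also have "\<dots> \<le> ereal (energy \<Omega> p f u + C * (em powr p + ?I))"
    proof -
      have "measure lebesgue \<Omega> / p * em powr p \<le> C * em powr p"
        using C(2) by (rule mult_right_mono) simp
      moreover have "2 / p * \<bar>c\<bar> powr p * ?I \<le> C * ?I"
        using C(3) by (rule mult_right_mono) simp
      ultimately show ?thesis
        using gap by (simp add: distrib_left)
    qed
    finally have "relaxed_energy \<Omega> p f em ep ue \<le> ereal (C * (em powr p + ?I)) + ereal (energy \<Omega> p f u)"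
      by (simp add: add.commute)
    then show ?thesis
      \<comment> \<open>The energy of \<open>u\<close> is a real number, so it may be moved across
        the inequality in \<open>ereal\<close>.\<close>
      by (subst ereal_minus_le) auto
  qed
  with C(1) show ?thesis
    by blast
qed

end
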